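(* Let $L$ be the Lelek fan. There is a homeomorphism $h:L\to L$ such that $(L,h)$ is chaotic in the sense of Robinson but not chaotic in the sense of Devaney. Also, there is a continuous mapping $f:L\to L$, which is not a homeomorphism, such that $(L,f)$ is chaotic in the sense of Robinson but not chaotic in the sense of Devaney.
   Context: A continuum is a non-empty compact connected metric space; a subcontinuum is a subspace of a continuum that is itself a continuum. A Cantor fan is any continuum homeomorphic to $\bigcup_{c\in K}A_c$, where $K\subseteq[0,1]$ is a Cantor set and, for each $c\in K$, $A_c$ is the convex segment in the plane from $(0,0)$ to $(c,-1)$. If $Y$ is a subcontinuum of a Cantor fan, a point $x\in Y$ is an end-point of $Y$ if for every arc $A$ in $Y$ that contains $x$, $x$ is an end-point of $A$; $E(Y)$ is the set of end-points of $Y$. A Lelek fan is a non-degenerate (more than one point) subcontinuum $Y$ of a Cantor fan with $\overline{E(Y)}=Y$. Any two Lelek fans are homeomorphic. A dynamical system is a pair $(X,f)$ where $(X,d)$ is a compact metric space and $f:X\to X$ is continuous. $(X,f)$ is transitive if for all non-empty open $U,V\subseteq X$ there is a non-negative integer $n$ with $f^n(U)\cap V\ne\emptyset$. $(X,f)$ has sensitive dependence on initial conditions if there is $\varepsilon>0$ such that for each $x\in X$ and each $\delta>0$ there are $y\in X$ with $d(x,y)<\delta$ and a positive integer $n$ with $d(f^n(x),f^n(y))>\varepsilon$ (for compact $X$ this does not depend on the choice of compatible metric). $\mathcal P(f)$ denotes the set of periodic points, i.e. points $p$ with $f^n(p)=p$ for some positive integer $n$. $(X,f)$ is chaotic in the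 sense of Robinson if it is transitive and has sensitive dependence on initial conditions. $(X,f)$ is chaotic in the sense of Devaney if it is transitive and $\mathcal P(f)$ is dense in $X$. *)

theory Defs
  imports "HOL-Analysis.Analysis"
begin

definition continuum :: "'a::metric_space set \<Rightarrow> bool" where
  "continuum X \<longleftrightarrow> X \<noteq> {} \<and> compact X \<and> connected X"

text \<open>The ternary Cantor set: all sums of a series with ternary digits 0 and 2.\<close>

definition ternary_cantor_set :: "real set" where
  "ternary_cantor_set = range (\<lambda>a :: nat \<Rightarrow> bool. \<Sum>n. (if a n then 2 else 0) / 3 ^ Suc n)"

definition cantor_set :: "'a::topological_space set \<Rightarrow> bool" where
  "cantor_set K \<longleftrightarrow> K homeomorphic ternary_cantor_set"

definition planar_fan :: "real set \<Rightarrow> (real \<times> real) set" where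
  "planar_fan K = (\<Union>c\<in>K. closed_segment (0, 0) (c, -1))"

definition cantor_fan :: "'a::metric_space set \<Rightarrow> bool" where
  "cantor_fan C \<longleftrightarrow>
     continuum C \<and> (\<exists>K. K \<subseteq> {0..1} \<and> cantor_set K \<and> C homeomorphic planar_fan K)"

text \<open>An arc in \<open>Y\<close> is the image of an injective path \<open>g\<close>, and its end-points are the two
  ends of \<open>g\<close>, independently of the choice of \<open>g\<close>.\<close>

definition fan_endpoints :: "'a::metric_space set \<Rightarrow> 'a set" where
  "fan_endpoints Y = {x \<in> Y. \<forall>g. arc g \<and> path_image g \<subseteq> Y \<and> x \<in> path_image g
                               \<longrightarrow> x = pathstart g \<or> x = pathfinish g}"

text \<open>As \<open>Y\<close> is compact, hence closed, the closure in the ambient space is the closure in \<open>Y\<close>.\<close>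

definition lelek_fan :: "'a::metric_space set \<Rightarrow> bool" where
  "lelek_fan Y \<longleftrightarrow>
     (\<exists>C. cantor_fan C \<and> Y \<subseteq> C) \<and> continuum Y \<and> (\<exists>x\<in>Y. \<exists>y\<in>Y. x \<noteq> y) \<and>
     closure (fan_endpoints Y) = Y"

text \<open>A self-map of \<open>X\<close> is represented by a function on the whole type that maps \<open>X\<close> into \<open>X\<close>;
  its values outside \<open>X\<close> are irrelevant in everything below.\<close>

definition dynamical_system :: "'a::metric_space set \<Rightarrow> ('a \<Rightarrow> 'a) \<Rightarrow> bool" where
  "dynamical_system X f \<longleftrightarrow> compact X \<and> continuous_on X f \<and> f ` X \<subseteq> X"

definition transitive_on :: "'a::metric_space set \<Rightarrow> ('a \<Rightarrow> 'a) \<Rightarrow> bool" where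
  "transitive_on X f \<longleftrightarrow>
     (\<forall>U V. openin (top_of_set X) U \<and> U \<noteq> {} \<and> openin (top_of_set X) V \<and> V \<noteq> {}
        \<longrightarrow> (\<exists>n. (f ^^ n) ` U \<inter> V \<noteq> {}))"

definition sensitive_on :: "'a::metric_space set \<Rightarrow> ('a \<Rightarrow> 'a) \<Rightarrow> bool" where
  "sensitive_on X f \<longleftrightarrow>
     (\<exists>\<epsilon>>0. \<forall>x\<in>X. \<forall>\<delta>>0. \<exists>y\<in>X. dist x y < \<delta> \<and>
        (\<exists>n>0. dist ((f ^^ n) x) ((f ^^ n) y) > \<epsilon>))"

definition periodic_points_on :: "'a::metric_space set \<Rightarrow> ('a \<Rightarrow> 'a) \<Rightarrow> 'a set" where
  "periodic_points_on X f = {p \<in> X. \<exists>n>0. (f ^^ n) p = p}"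

definition robinson_chaotic :: "'a::metric_space set \<Rightarrow> ('a \<Rightarrow> 'a) \<Rightarrow> bool" where
  "robinson_chaotic X f \<longleftrightarrow> dynamical_system X f \<and> transitive_on X f \<and> sensitive_on X f"

text \<open>\<open>X \<subseteq> closure P\<close> for \<open>P \<subseteq> X\<close> says that \<open>P\<close> is dense in the subspace \<open>X\<close>.\<close>

definition devaney_chaotic :: "'a::metric_space set \<Rightarrow> ('a \<Rightarrow> 'a) \<Rightarrow> bool" where
  "devaney_chaotic X f \<longleftrightarrow>
     dynamical_system X f \<and> transitive_on X f \<and> X \<subseteq> closure (periodic_points_on X f)"

end

theory Submission
  imports Defs
begin

text \<open>
  A Lelek fan is determined, up to homeomorphism, by the lengths of its legs, regarded as an upper
  semicontinuous function \<open>\<phi>\<close> on a compact totally disconnected base space: the fan is the region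
  \<open>0 \<le> t \<le> \<phi> c\<close> with its bottom collapsed to a point.  Density of the end-points says that the graph of
  \<open>\<phi>\<close> is dense in that region; such functions are called Lelek functions here.  That every Lelek fan
  arises in this way is \<open>lelek_fan_chart\<close>.

  Any two Lelek functions \<open>\<phi>\<close> and \<open>\<psi>\<close> are related by \<open>\<psi> (h c) = \<alpha> c * \<phi> c\<close> for a homeomorphism \<open>h\<close> of the
  bases and a positive continuous function \<open>\<alpha>\<close> (\<open>lelek_functions_equivalent\<close>).  This is a back-and-forth
  argument: both bases are cut into matching clopen pieces, and because a Lelek function
  takes values densely below the maximum on every piece, the pieces can be chosen so that the
  quotients of the maxima of \<open>\<psi>\<close> and \<open>\<phi>\<close> on matching pieces converge uniformly.  Consequently it
  suffices to find the dynamics over one convenient Lelek function, and different maps may use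
  different ones (\<open>fan_chart_transfer\<close>).

  The convenient base consists of bi-infinite binary sequences.  Along a sequence the height of a
  point is multiplied at each time step by \<open>exp (sqrt 2)\<close> or by \<open>exp (- 1)\<close>, according to the letter
  read, and a point belongs to the fan if its height stays at most 1 at all times, past and future.
  The shift together with this multiplication is a homeomorphism of the fan.  As the numbers
  \<open>q * sqrt 2 - p\<close> with natural coefficients are dense in the reals, an orbit segment can be continued
  by any other one after a suitable detour (\<open>splice\<close>); this yields the Lelek property of the model,
  transitivity and sensitivity.  As \<open>sqrt 2\<close> is irrational, no point of positive height is periodic, so the
  only periodic point is the apex and the periodic points are not dense.

  Forgetting the letters at negative times gives a factor of this system, which again lives on a Lelek
  fan and is no longer injective.  Transitivity passes to factors, and sensitivity and the lack of
  periodic points survive because the factor map identifies only points of equal height (\<open>factor_of_turn_chaotic\<close>).\<close>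

section \<open>Fans over a base space\<close>

text \<open>Collapsing the bottom \<open>t = 0\<close> of the region under the graph of \<open>\<phi>\<close> to one point yields a fan with
  one leg of length \<open>\<phi> c\<close> for each base point \<open>c\<close>.  The collapse is never formed as a quotient space:
  a chart presents a given space as that quotient, so the same fan can be charted over different
  bases.\<close>

definition fan_body :: "'c set \<Rightarrow> ('c \<Rightarrow> real) \<Rightarrow> ('c \<times> real) set" where
  "fan_body C \<phi> = {(c, t). c \<in> C \<and> 0 \<le> t \<and> t \<le> \<phi> c}"

definition fan_chart ::
    "'c::topological_space set \<Rightarrow> ('c \<Rightarrow> real) \<Rightarrow> ('c \<times> real \<Rightarrow> 'a::metric_space) \<Rightarrow> 'a set \<Rightarrow> bool" where
  "fan_chart C \<phi> \<pi> L \<longleftrightarrow>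
     continuous_on (fan_body C \<phi>) \<pi> \<and> \<pi> ` fan_body C \<phi> = L \<and>
     (\<forall>p\<in>fan_body C \<phi>. \<forall>q\<in>fan_body C \<phi>. \<pi> p = \<pi> q \<longleftrightarrow> p = q \<or> snd p = 0 \<and> snd q = 0)"

lemma in_fan_body [simp]: "(c, t) \<in> fan_body C \<phi> \<longleftrightarrow> c \<in> C \<and> 0 \<le> t \<and> t \<le> \<phi> c"
  by (simp add: fan_body_def)

text \<open>A continuous surjection from a compact space onto a Hausdorff space is closed, hence a quotient
  map.\<close>

lemma compact_quotient_lift:
  fixes \<pi> :: "'c::topological_space \<Rightarrow> 'a::t2_space" and G :: "'c \<Rightarrow> 'b::t2_space"
  assumes E: "compact E" and \<pi>: "continuous_on E \<pi>" and G: "continuous_on E G"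
    and fib: "\<And>p q. p \<in> E \<Longrightarrow> q \<in> E \<Longrightarrow> \<pi> p = \<pi> q \<Longrightarrow> G p = G q"
  obtains f where "continuous_on (\<pi> ` E) f" "\<And>p. p \<in> E \<Longrightarrow> f (\<pi> p) = G p"
proof
  define f where "f x = G (SOME p. p \<in> E \<and> \<pi> p = x)" for x
  show f: "f (\<pi> p) = G p" if "p \<in> E" for p
  proof -
    have "(SOME q. q \<in> E \<and> \<pi> q = \<pi> p) \<in> E \<and> \<pi> (SOME q. q \<in> E \<and> \<pi> q = \<pi> p) = \<pi> p"
      by (rule someI [of _ p]) (use that in auto)
    then show ?thesis unfolding f_def using fib that by blast
  qed
  show "continuous_on (\<pi> ` E) f"
    unfolding continuous_on_closed_vimage[OF compact_imp_closed[OF compact_continuous_image[OF \<pi> E]]]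
  proof (intro allI impI)
    fix T :: "'b set" assume "closed T"
    have "closedin (top_of_set E) (E \<inter> G -` T)"
      using G \<open>closed T\<close> by (rule continuous_closedin_preimage)
    then have "compact (E \<inter> G -` T)" using E closedin_compact by blast
    then have "compact (\<pi> ` (E \<inter> G -` T))"
      by (rule compact_continuous_image[rotated]) (meson \<pi> continuous_on_subset inf_le1)
    moreover have "\<pi> ` (E \<inter> G -` T) = f -` T \<inter> \<pi> ` E" using f by force
    ultimately show "closed (f -` T \<inter> \<pi> ` E)" by (metis compact_imp_closed)
  qed
qed

lemma fan_chart_lift:
  fixes F :: "'c::topological_space \<times> real \<Rightarrow> 'c \<times> real"
  assumes chart: "fan_chart C \<phi> \<pi> L" and cpt: "compact (fan_body C \<phi>)"
    and F: "continuous_on (fan_body C \<phi>) F" "F ` fan_body C \<phi> \<subseteq> fan_body C \<phi>"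
    and zero: "\<And>p. p \<in> fan_body C \<phi> \<Longrightarrow> snd p = 0 \<Longrightarrow> snd (F p) = 0"
  obtains f where "continuous_on L f" "f ` L \<subseteq> L" "\<And>p. p \<in> fan_body C \<phi> \<Longrightarrow> f (\<pi> p) = \<pi> (F p)"
proof -
  let ?E = "fan_body C \<phi>"
  have \<pi>: "continuous_on ?E \<pi>" "\<pi> ` ?E = L"
    and inj: "\<And>p q. p \<in> ?E \<Longrightarrow> q \<in> ?E \<Longrightarrow> \<pi> p = \<pi> q \<longleftrightarrow> p = q \<or> snd p = 0 \<and> snd q = 0"
    using chart by (auto simp: fan_chart_def)
  have mem: "F p \<in> ?E" if "p \<in> ?E" for p using F(2) that by blast
  obtain f where f: "continuous_on (\<pi> ` ?E) f" "\<And>p. p \<in> ?E \<Longrightarrow> f (\<pi> p) = (\<pi> \<circ> F) p"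
  proof (rule compact_quotient_lift[OF cpt \<pi>(1), of "\<pi> \<circ> F"])
    show "continuous_on ?E (\<pi> \<circ> F)"
      by (rule continuous_on_compose[OF F(1)]) (meson F(2) \<pi>(1) continuous_on_subset)
    fix p q assume "p \<in> ?E" "q \<in> ?E" "\<pi> p = \<pi> q"
    then have "p = q \<or> snd (F p) = 0 \<and> snd (F q) = 0" using inj zero by blast
    then show "(\<pi> \<circ> F) p = (\<pi> \<circ> F) q"
      using inj[OF mem[OF \<open>p \<in> ?E\<close>] mem[OF \<open>q \<in> ?E\<close>]] by auto
  qed blast
  show thesis
  proof
    show "continuous_on L f" using f(1) \<pi>(2) by simp
    show "f (\<pi> p) = \<pi> (F p)" if "p \<in> ?E" for p using f(2)[OF that] by simp
    then show "f ` L \<subseteq> L" using \<pi>(2) mem by auto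
  qed
qed

text \<open>Cantor's intersection theorem for a Hausdorff space.\<close>

lemma nested_compact_meet:
  fixes S :: "nat \<Rightarrow> 'c::t2_space set"
  assumes "\<And>n. compact (S n)" "\<And>n. S n \<noteq> {}" and anti: "\<And>m n. m \<le> n \<Longrightarrow> S n \<subseteq> S m"
  obtains c where "\<And>n. c \<in> S n"
proof -
  have "S 0 \<inter> (\<Inter>n\<in>UNIV. S n) \<noteq> {}"
  proof (rule compact_imp_fip_image)
    fix I :: "nat set" assume "finite I"
    then have "S (Max (insert 0 I)) \<subseteq> S n" if "n \<in> I" for n
      by (intro anti) (simp add: that)
    then show "S 0 \<inter> (\<Inter>n\<in>I. S n) \<noteq> {}"
      using assms(2)[of "Max (insert 0 I)"] anti[of 0 "Max (insert 0 I)"] by blast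
  qed (use assms compact_imp_closed in blast)+
  then show thesis using that by blast
qed

definition clopen_in :: "'c::topological_space set \<Rightarrow> 'c set \<Rightarrow> bool" where
  "clopen_in C U \<longleftrightarrow> openin (top_of_set C) U \<and> closedin (top_of_set C) U"

lemma clopen_in_subset: "clopen_in C U \<Longrightarrow> U \<subseteq> C"
  unfolding clopen_in_def by (blast dest: openin_imp_subset)

lemma clopen_in_self: "clopen_in C C"
  by (simp add: clopen_in_def)

lemma clopen_in_Int: "clopen_in C U \<Longrightarrow> clopen_in C V \<Longrightarrow> clopen_in C (U \<inter> V)"
  by (simp add: clopen_in_def openin_Int closedin_Int)

lemma clopen_in_Diff: "clopen_in C U \<Longrightarrow> clopen_in C V \<Longrightarrow> clopen_in C (U - V)"
  by (simp add: clopen_in_def openin_diff closedin_diff)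

text \<open>Compactness of the body says that \<open>\<phi>\<close> is bounded and upper semicontinuous.  The sequence \<open>B\<close> of
  clopen sets, which tells any two base points apart, makes the base totally disconnected and
  second countable without mentioning a metric.  The last two conditions express that the tips
  \<open>(c, \<phi> c)\<close> with \<open>\<phi> c > 0\<close> are dense in the body: above each clopen set there is a leg, and every
  interval below the height of some leg contains the height of a tip.\<close>

locale lelek_function =
  fixes C :: "'c::t2_space set" and \<phi> :: "'c \<Rightarrow> real" and B :: "nat \<Rightarrow> 'c set"
  assumes nonempty: "C \<noteq> {}"
    and compact_body: "compact (fan_body C \<phi>)"
    and nonneg: "\<And>c. c \<in> C \<Longrightarrow> 0 \<le> \<phi> c"
    and clopen_B: "\<And>j. clopen_in C (C \<inter> B j)"
    and separated: "\<And>x y. x \<in> C \<Longrightarrow> y \<in> C \<Longrightarrow> x \<noteq> y \<Longrightarrow> \<exists>j. (x \<in> B j) \<noteq> (y \<in> B j)"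
    and positive_somewhere: "\<And>U. clopen_in C U \<Longrightarrow> U \<noteq> {} \<Longrightarrow> \<exists>c\<in>U. 0 < \<phi> c"
    and values_dense: "\<And>U c a b. clopen_in C U \<Longrightarrow> c \<in> U \<Longrightarrow> 0 \<le> a \<Longrightarrow> a < b \<Longrightarrow> b \<le> \<phi> c \<Longrightarrow>
                          \<exists>c'\<in>U. a < \<phi> c' \<and> \<phi> c' < b"

section \<open>Lelek functions agree up to a positive factor\<close>

context lelek_function
begin

lemma compact_base: "compact C"
proof -
  have "C = fst ` fan_body C \<phi>" using nonneg by (force simp: fan_body_def)
  also have "compact \<dots>"
    by (intro compact_continuous_image continuous_on_fst continuous_on_id compact_body)
  finally show ?thesis .
qed

lemma compact_clopen: "clopen_in C U \<Longrightarrow> compact U"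
  using compact_base closedin_compact unfolding clopen_in_def by blast

lemma closed_clopen: "clopen_in C U \<Longrightarrow> closed U"
  by (simp add: compact_clopen compact_imp_closed)

definition peak :: "'c set \<Rightarrow> real" where
  "peak U = Sup (\<phi> ` U)"

lemma peak_attained:
  assumes U: "clopen_in C U" "U \<noteq> {}"
  obtains c where "c \<in> U" "\<phi> c = peak U" "\<And>c'. c' \<in> U \<Longrightarrow> \<phi> c' \<le> peak U"
proof -
  have UC: "U \<subseteq> C" using U clopen_in_subset by blast
  let ?S = "fan_body C \<phi> \<inter> U \<times> UNIV"
  have "compact ?S"
    by (intro compact_Int_closed compact_body closed_Times closed_clopen U closed_UNIV)
  then have "compact (snd ` ?S)"
    by (intro compact_continuous_image continuous_on_snd continuous_on_id)
  moreover have mem: "(c, \<phi> c) \<in> ?S" if "c \<in> U" for c using that UC nonneg by auto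
  then have "snd ` ?S \<noteq> {}" using U(2) by blast
  ultimately obtain s where "s \<in> snd ` ?S" and max: "\<And>t. t \<in> snd ` ?S \<Longrightarrow> t \<le> s"
    using compact_attains_sup by metis
  then obtain c where c: "c \<in> U" "s \<le> \<phi> c" by auto
  have le: "\<phi> c' \<le> \<phi> c" if "c' \<in> U" for c'
    using max[of "\<phi> c'"] mem[OF that] c by force
  then have "peak U = \<phi> c" unfolding peak_def
    by (intro cSup_eq_maximum) (use c in auto)
  with c le show thesis by (intro that[of c]) auto
qed

lemma le_peak: "clopen_in C U \<Longrightarrow> c \<in> U \<Longrightarrow> \<phi> c \<le> peak U"
  by (metis empty_iff peak_attained)

lemma peak_pos: "clopen_in C U \<Longrightarrow> U \<noteq> {} \<Longrightarrow> 0 < peak U"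
  by (meson le_peak less_le_trans positive_somewhere)

lemma peak_mono: "clopen_in C U \<Longrightarrow> clopen_in C V \<Longrightarrow> U \<subseteq> V \<Longrightarrow> U \<noteq> {} \<Longrightarrow> peak U \<le> peak V"
  by (metis le_peak peak_attained subsetD)

definition cell :: "'c \<Rightarrow> nat \<Rightarrow> 'c set" where
  "cell c n = {c' \<in> C. \<forall>j<n. c' \<in> B j \<longleftrightarrow> c \<in> B j}"

lemma clopen_cell: "clopen_in C (cell c n)"
proof (induction n)
  case 0 then show ?case by (simp add: cell_def clopen_in_self)
next
  case (Suc n)
  have "cell c (Suc n) = (if c \<in> B n then cell c n \<inter> (C \<inter> B n) else cell c n - (C \<inter> B n))"
    by (auto simp: cell_def less_Suc_eq)
  then show ?case using Suc by (auto intro!: clopen_in_Int clopen_in_Diff clopen_B simp del: Int_iff split: if_splits)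
qed

lemma cell_self: "c \<in> C \<Longrightarrow> c \<in> cell c n"
  by (simp add: cell_def)

lemma cell_antimono: "m \<le> n \<Longrightarrow> cell c n \<subseteq> cell c m"
  by (auto simp: cell_def)

text \<open>The cells form a neighbourhood basis at their centre: compactness stops the nested cells from
  all meeting a compact set that misses their only common point.\<close>

lemma cell_avoids_compact:
  assumes "compact P" "P \<subseteq> C" "c \<in> C" "c \<notin> P"
  obtains n where "cell c n \<inter> P = {}"
proof (rule ccontr)
  assume "\<not> thesis"
  then have ne: "cell c n \<inter> P \<noteq> {}" for n using that by blast
  obtain c' where c': "\<And>n. c' \<in> cell c n \<inter> P"
  proof (rule nested_compact_meet)
    show "compact (cell c n \<inter> P)" for n
      using assms(1) compact_clopen[OF clopen_cell] by (simp add: compact_Int)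
    show "cell c n \<inter> P \<subseteq> cell c m \<inter> P" if "m \<le> n" for m n
      using cell_antimono[OF that] by blast
  qed (use ne in auto)
  then have "c' \<noteq> c" "c' \<in> C" using assms by blast+
  then obtain j where "(c' \<in> B j) \<noteq> (c \<in> B j)" using separated \<open>c \<in> C\<close> by blast
  then show False using c'[of "Suc j"] by (simp add: cell_def)
qed

text \<open>The base points whose leg reaches height \<open>a\<close> form a compact set, as a projection of a compact part
  of the body.\<close>

lemma upper_semicontinuous:
  assumes "c \<in> C" "\<phi> c < a"
  obtains n where "\<And>c'. c' \<in> cell c n \<Longrightarrow> \<phi> c' < a"
proof -
  define P where "P = fst ` (fan_body C \<phi> \<inter> UNIV \<times> {a..})"
  have "compact P" unfolding P_def
    by (intro compact_continuous_image continuous_on_fst continuous_on_id compact_Int_closed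
        compact_body closed_Times closed_UNIV closed_atLeast)
  moreover have "P \<subseteq> C" "c \<notin> P" using assms by (auto simp: P_def)
  ultimately obtain n where n: "cell c n \<inter> P = {}" using cell_avoids_compact assms(1) by metis
  have "\<phi> c' < a" if "c' \<in> cell c n" for c'
  proof (rule ccontr)
    assume "\<not> \<phi> c' < a"
    moreover have "c' \<in> C" using that by (simp add: cell_def)
    ultimately have "(c', \<phi> c') \<in> fan_body C \<phi> \<inter> UNIV \<times> {a..}" using nonneg by auto
    then have "c' \<in> P" unfolding P_def by force
    then show False using n that by blast
  qed
  then show thesis using that by blast
qed

definition splits :: "'c set \<Rightarrow> 'c set \<Rightarrow> bool" where
  "splits U' U \<longleftrightarrow> clopen_in C U' \<and> U' \<noteq> {} \<and> U' \<subseteq> U \<and> U - U' \<noteq> {}"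

text \<open>The peak of \<open>U\<close> stays in one part of the split while the peak of the other part can be prescribed
  up to an arbitrarily small error.  This freedom is what distinguishes Lelek functions: a tip of
  height slightly below \<open>r\<close> exists in \<open>U\<close>, and by upper semicontinuity a small clopen set around its
  base point has a peak below \<open>r\<close>.\<close>

lemma split_off_peak:
  assumes U: "clopen_in C U" "U \<noteq> {}" and "0 \<le> a" "a < r" "r \<le> peak U"
  obtains U' where "splits U' U" "peak (U - U') = peak U" "a < peak U'" "peak U' < r"
proof -
  obtain c1 where c1: "c1 \<in> U" "\<phi> c1 = peak U" using peak_attained U by metis
  then obtain c2 where c2: "c2 \<in> U" "a < \<phi> c2" "\<phi> c2 < r"
    using values_dense U(1) assms by metis
  have inC: "c1 \<in> C" "c2 \<in> C" using U c1 c2 clopen_in_subset by blast+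
  obtain n where n: "\<And>c'. c' \<in> cell c2 n \<Longrightarrow> \<phi> c' < r"
    using upper_semicontinuous inC c2 by metis
  define U' where "U' = U \<inter> cell c2 n"
  have clo: "clopen_in C U'" "clopen_in C (U - U')"
    unfolding U'_def by (simp_all add: U clopen_cell clopen_in_Diff clopen_in_Int)
  have "c2 \<in> U'" using c2 inC cell_self by (auto simp: U'_def)
  have "c1 \<notin> U'" using n[of c1] c1 assms by (auto simp: U'_def)
  show thesis
  proof
    show "splits U' U" unfolding splits_def
      using clo \<open>c2 \<in> U'\<close> \<open>c1 \<notin> U'\<close> \<open>c1 \<in> U\<close> by (auto simp: U'_def)
    show "peak (U - U') = peak U"
    proof (rule antisym)
      show "peak (U - U') \<le> peak U"
        using peak_mono[OF clo(2) U(1)] \<open>c1 \<notin> U'\<close> \<open>c1 \<in> U\<close> by blast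
      show "peak U \<le> peak (U - U')"
        using le_peak[OF clo(2), of c1] c1 \<open>c1 \<notin> U'\<close> by auto
    qed
    show "a < peak U'" using le_peak[OF clo(1) \<open>c2 \<in> U'\<close>] c2 by simp
    show "peak U' < r"
      by (metis IntD2 U'_def \<open>c2 \<in> U'\<close> clo(1) empty_iff n peak_attained)
  qed
qed

definition decided :: "nat \<Rightarrow> 'c set \<Rightarrow> bool" where
  "decided j U \<longleftrightarrow> U \<subseteq> B j \<or> U \<inter> B j = {}"

lemma split_by_generator:
  assumes U: "clopen_in C U" "U \<noteq> {}"
  obtains U' where "splits U' U" "decided j U'" "decided j (U - U')"
proof (cases "decided j U")
  case True
  obtain U' where "splits U' U"
    using split_off_peak[OF U, of 0 "peak U"] peak_pos[OF U] by auto
  then show thesis using True that[of U'] unfolding decided_def splits_def by blast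
next
  case False
  have "U \<subseteq> C" using U clopen_in_subset by blast
  then have eq: "U \<inter> B j = U \<inter> (C \<inter> B j)" by blast
  have "splits (U \<inter> B j) U"
    unfolding splits_def using False U clopen_B clopen_in_Int eq decided_def by auto
  then show thesis by (rule that) (auto simp: decided_def)
qed

lemma peak_split:
  assumes U: "clopen_in C U" and s: "splits U' U"
  shows "peak U' \<le> peak U" "peak (U - U') \<le> peak U" "peak U' = peak U \<or> peak (U - U') = peak U"
proof -
  have clo: "clopen_in C U'" "clopen_in C (U - U')" and ne: "U' \<noteq> {}" "U - U' \<noteq> {}" "U' \<subseteq> U"
    using s U clopen_in_Diff by (auto simp: splits_def)
  show 1: "peak U' \<le> peak U" "peak (U - U') \<le> peak U"
    using peak_mono[OF clo(1) U] peak_mono[OF clo(2) U] ne by auto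
  have "U \<noteq> {}" using ne by blast
  then obtain c where "c \<in> U" "\<phi> c = peak U" using peak_attained[OF U] by metis
  then show "peak U' = peak U \<or> peak (U - U') = peak U"
    using 1 le_peak[OF clo(1), of c] le_peak[OF clo(2), of c] by fastforce
qed

end

locale lelek_pair = X: lelek_function C \<phi> B + Y: lelek_function D \<psi> B'
  for C :: "'c::t2_space set" and \<phi> B and D :: "'d::t2_space set" and \<psi> B'
begin

text \<open>The logarithm of the factor by which the peak over \<open>V\<close> exceeds the peak over \<open>U\<close>.  For sets shrinking
  to points \<open>c\<close> and \<open>d\<close> it should converge to the logarithm of the quotient of the leg lengths
  \<open>\<psi> d / \<phi> c\<close>.\<close>

definition gap :: "'c set \<Rightarrow> 'd set \<Rightarrow> real" where
  "gap U V = ln (Y.peak V) - ln (X.peak U)"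

text \<open>In every split of \<open>V\<close> one part inherits the peak of \<open>V\<close>.  Splitting \<open>U\<close> so that the corresponding part
  inherits the peak of \<open>U\<close>, and the other peaks are nearly in the same proportion, changes the gap
  on one side by nothing and on the other side by as little as desired.\<close>

lemma match_split:
  assumes U: "clopen_in C U" "U \<noteq> {}" and V: "clopen_in D V" "V \<noteq> {}"
    and s: "Y.splits V' V" and "0 < \<epsilon>"
  obtains U' where "X.splits U' U" "\<bar>gap U' V' - gap U V\<bar> < \<epsilon>"
    "\<bar>gap (U - U') (V - V') - gap U V\<bar> < \<epsilon>"
proof -
  have clo: "clopen_in D V'" "clopen_in D (V - V')" and ne: "V' \<noteq> {}" "V - V' \<noteq> {}"
    using s V clopen_in_Diff by (auto simp: Y.splits_def)
  have pos: "0 < X.peak U" "0 < Y.peak V" "0 < Y.peak V'" "0 < Y.peak (V - V')"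
    using X.peak_pos Y.peak_pos U V clo ne by auto
  have step: thesis if W: "0 < w" "w \<le> Y.peak V" 
    and *: "\<And>U'. X.splits U' U \<Longrightarrow> X.peak (U - U') = X.peak U \<Longrightarrow>
            \<bar>ln w - ln (X.peak U') - gap U V\<bar> < \<epsilon> \<Longrightarrow> thesis" for w
  proof -
    \<comment> \<open>\<open>w\<close> is the peak of the part of \<open>V\<close> that need not contain the highest point; the part of \<open>U\<close>
      with peak \<open>r\<close> would reproduce the gap exactly\<close>
    define r where "r = X.peak U * w / Y.peak V"
    have r: "0 < r" "r \<le> X.peak U" using pos W by (simp_all add: r_def field_simps)
    have lnr: "ln r = ln (X.peak U) + ln w - ln (Y.peak V)"
      using pos W by (simp add: r_def ln_mult ln_div)
    obtain U' where U': "X.splits U' U" "X.peak (U - U') = X.peak U"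
        "r * exp (- \<epsilon>) < X.peak U'" "X.peak U' < r"
      using X.split_off_peak[OF U, of "r * exp (-\<epsilon>)" r] r \<open>0 < \<epsilon>\<close> by auto
    have pU: "0 < X.peak U'" using U'(1) by (simp add: X.peak_pos X.splits_def)
    have "ln (r * exp (- \<epsilon>)) < ln (X.peak U')" using U'(3) r pU by (subst ln_less_cancel_iff) auto
    then have "ln r - \<epsilon> < ln (X.peak U')" using r by (simp add: ln_mult)
    moreover have "ln (X.peak U') < ln r" using U'(4) r pU by simp
    ultimately show thesis
      by (intro *[OF U'(1,2)]) (simp add: lnr gap_def)
  qed
  consider "Y.peak (V - V') = Y.peak V" | "Y.peak V' = Y.peak V"
    using Y.peak_split[OF V(1) s] by blast
  then show thesis
  proof cases
    case 1
    show thesis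
    proof (rule step[of "Y.peak V'"])
      fix U' assume "X.splits U' U" "X.peak (U - U') = X.peak U"
        "\<bar>ln (Y.peak V') - ln (X.peak U') - gap U V\<bar> < \<epsilon>"
      then show thesis using 1 \<open>0 < \<epsilon>\<close> by (intro that[of U']) (auto simp: gap_def)
    qed (use pos Y.peak_split[OF V(1) s] in auto)
  next
    case 2
    show thesis
    proof (rule step[of "Y.peak (V - V')"])
      fix U' assume U': "X.splits U' U" "X.peak (U - U') = X.peak U"
        "\<bar>ln (Y.peak (V - V')) - ln (X.peak U') - gap U V\<bar> < \<epsilon>"
      then have "X.splits (U - U') U" and "U - (U - U') = U'"
        using U(1) clopen_in_Diff by (auto simp: X.splits_def)
      then show thesis using 2 U' \<open>0 < \<epsilon>\<close> by (intro that[of "U - U'"]) (auto simp: gap_def)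
    qed (use pos Y.peak_split[OF V(1) s] in auto)
  qed
qed

end

context lelek_pair begin

interpretation swap: lelek_pair D \<psi> B' C \<phi> B by unfold_locales

lemma match_split_swapped:
  assumes U: "clopen_in C U" "U \<noteq> {}" and V: "clopen_in D V" "V \<noteq> {}"
    and s: "X.splits U' U" and "0 < \<epsilon>"
  obtains V' where "Y.splits V' V" "\<bar>gap U' V' - gap U V\<bar> < \<epsilon>"
    "\<bar>gap (U - U') (V - V') - gap U V\<bar> < \<epsilon>"
proof -
  have "swap.gap V U = - gap U V" for U V by (simp add: gap_def swap.gap_def)
  then show thesis using swap.match_split[OF V U s \<open>0 < \<epsilon>\<close>] that
    by (smt (verit))
qed

text \<open>One level of the back-and-forth construction.  Even levels refine \<open>U\<close> by the next generator of the
  first base and let \<open>V\<close> follow, odd levels exchange the roles; so the parts shrink to points on both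
  sides.  The errors \<open>(1/2)^n\<close> are summable, which makes the gaps converge uniformly.\<close>

definition good_step :: "nat \<Rightarrow> 'c set \<times> 'd set \<Rightarrow> 'c set \<times> 'd set \<Rightarrow> bool" where
  "good_step n = (\<lambda>(U, V) (U', V'). X.splits U' U \<and> Y.splits V' V \<and>
     \<bar>gap U' V' - gap U V\<bar> < (1/2)^n \<and> \<bar>gap (U - U') (V - V') - gap U V\<bar> < (1/2)^n \<and>
     (even n \<longrightarrow> X.decided (n div 2) U' \<and> X.decided (n div 2) (U - U')) \<and>
     (odd n \<longrightarrow> Y.decided (n div 2) V' \<and> Y.decided (n div 2) (V - V')))"

lemma good_step_exists:
  assumes U: "clopen_in C U" "U \<noteq> {}" and V: "clopen_in D V" "V \<noteq> {}"
  shows "\<exists>q. good_step n (U, V) q"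
proof (cases "even n")
  case True
  obtain U' where U': "X.splits U' U" "X.decided (n div 2) U'" "X.decided (n div 2) (U - U')"
    using X.split_by_generator[OF U] by metis
  obtain V' where "Y.splits V' V" "\<bar>gap U' V' - gap U V\<bar> < (1/2)^n"
    "\<bar>gap (U - U') (V - V') - gap U V\<bar> < (1/2)^n"
    using match_split_swapped[OF U V U'(1)] by (metis half_gt_zero zero_less_one zero_less_power)
  then have "good_step n (U, V) (U', V')" using U' True by (simp add: good_step_def)
  then show ?thesis ..
next
  case False
  obtain V' where V': "Y.splits V' V" "Y.decided (n div 2) V'" "Y.decided (n div 2) (V - V')"
    using Y.split_by_generator[OF V] by metis
  obtain U' where "X.splits U' U" "\<bar>gap U' V' - gap U V\<bar> < (1/2)^n"
    "\<bar>gap (U - U') (V - V') - gap U V\<bar> < (1/2)^n"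
    using match_split[OF U V V'(1)] by (metis half_gt_zero zero_less_one zero_less_power)
  then have "good_step n (U, V) (U', V')" using V' False by (simp add: good_step_def)
  then show ?thesis ..
qed

definition step :: "nat \<Rightarrow> 'c set \<times> 'd set \<Rightarrow> 'c set \<times> 'd set" where
  "step n p = (SOME q. good_step n p q)"

text \<open>A binary sequence \<open>x\<close> selects a branch of a tree of paired clopen sets; at each level the sets on the
  first side partition the first base, and those on the second side partition the second base.\<close>

primrec node :: "(nat \<Rightarrow> bool) \<Rightarrow> nat \<Rightarrow> 'c set \<times> 'd set" where
  "node x 0 = (C, D)"
| "node x (Suc n) =
     (let (U, V) = node x n; (U', V') = step n (node x n)
      in if x n then (U', V') else (U - U', V - V'))"

lemma node_clopen:
  "clopen_in C (fst (node x n))" "fst (node x n) \<noteq> {}"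
  "clopen_in D (snd (node x n))" "snd (node x n) \<noteq> {}"
  and good_step_node: "good_step n (node x n) (step n (node x n))"
proof -
  have some: "good_step m (node x m) (step m (node x m))"
    if "clopen_in C (fst (node x m)) \<and> fst (node x m) \<noteq> {} \<and>
        clopen_in D (snd (node x m)) \<and> snd (node x m) \<noteq> {}" for m
    unfolding step_def
    by (rule someI_ex) (metis that good_step_exists prod.collapse)
  have *: "clopen_in C (fst (node x m)) \<and> fst (node x m) \<noteq> {} \<and>
        clopen_in D (snd (node x m)) \<and> snd (node x m) \<noteq> {}" for m
  proof (induction m)
    case 0
    then show ?case by (simp add: clopen_in_self X.nonempty Y.nonempty)
  next
    case (Suc m)
    then show ?case using some[OF Suc]
      by (auto simp: good_step_def X.splits_def Y.splits_def clopen_in_Diff Let_def split: prod.splits)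
  qed
  show "clopen_in C (fst (node x n))" "fst (node x n) \<noteq> {}"
    "clopen_in D (snd (node x n))" "snd (node x n) \<noteq> {}"
    "good_step n (node x n) (step n (node x n))"
    using * some by auto
qed

lemma node_Suc_fst:
  "fst (node x (Suc n)) = (if x n then fst (step n (node x n)) else fst (node x n) - fst (step n (node x n)))"
  by (simp add: Let_def split: prod.splits)

lemma node_Suc_snd:
  "snd (node x (Suc n)) = (if x n then snd (step n (node x n)) else snd (node x n) - snd (step n (node x n)))"
  by (simp add: Let_def split: prod.splits)

declare node.simps(2) [simp del]

lemma step_subset: "fst (step n (node x n)) \<subseteq> fst (node x n)" "snd (step n (node x n)) \<subseteq> snd (node x n)"
  using good_step_node[of n x] by (auto simp: good_step_def X.splits_def Y.splits_def split: prod.splits)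

lemma node_antimono:
  assumes "m \<le> n" shows "fst (node x n) \<subseteq> fst (node x m)" "snd (node x n) \<subseteq> snd (node x m)"
proof -
  have "fst (node x (Suc k)) \<subseteq> fst (node x k)" "snd (node x (Suc k)) \<subseteq> snd (node x k)" for k
    using step_subset[of k x] by (auto simp only: node_Suc_fst node_Suc_snd split: if_splits)
  then show "fst (node x n) \<subseteq> fst (node x m)" "snd (node x n) \<subseteq> snd (node x m)"
    using lift_Suc_antimono_le[of "\<lambda>k. fst (node x k)"] lift_Suc_antimono_le[of "\<lambda>k. snd (node x k)"] assms
    by blast+
qed

lemma node_eq: "(\<And>k. k < n \<Longrightarrow> x k = y k) \<Longrightarrow> node x n = node y n"
  by (induction n) (simp_all add: node.simps(2))

lemma node_disjoint_fst:
  assumes "c \<in> fst (node x n)" "c \<in> fst (node y n)" shows "node x n = node y n"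
proof (rule node_eq)
  have "\<forall>k<m. x k = y k" if "m \<le> n" for m using that
  proof (induction m)
    case (Suc m)
    then have eq: "node x m = node y m" by (intro node_eq) simp
    have "c \<in> fst (node x (Suc m))" "c \<in> fst (node y (Suc m))"
      using node_antimono(1)[OF Suc.prems] assms by blast+
    then have "x m = y m" using eq by (simp only: node_Suc_fst split: if_splits) auto
    then show ?case using Suc less_Suc_eq by auto
  qed simp
  then show "\<And>k. k < n \<Longrightarrow> x k = y k" by blast
qed

lemma node_disjoint_snd:
  assumes "d \<in> snd (node x n)" "d \<in> snd (node y n)" shows "node x n = node y n"
proof (rule node_eq)
  have "\<forall>k<m. x k = y k" if "m \<le> n" for m using that
  proof (induction m)
    case (Suc m)
    then have eq: "node x m = node y m" by (intro node_eq) simp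
    have "d \<in> snd (node x (Suc m))" "d \<in> snd (node y (Suc m))"
      using node_antimono(2)[OF Suc.prems] assms by blast+
    then have "x m = y m" using eq by (simp only: node_Suc_snd split: if_splits) auto
    then show ?case using Suc less_Suc_eq by auto
  qed simp
  then show "\<And>k. k < n \<Longrightarrow> x k = y k" by blast
qed

text \<open>The node at level \<open>n\<close> depends only on the choices made before level \<open>n\<close>, so a branch may be steered by
  a rule \<open>Q\<close> that looks at the current node, for instance by following a given point.\<close>

lemma branch_by_rule: "\<exists>x. \<forall>n. x n = Q n (node x n)"
proof -
  define nxt :: "nat \<Rightarrow> 'c set \<times> 'd set \<Rightarrow> 'c set \<times> 'd set" where
    "nxt n p = (let (U, V) = p; (U', V') = step n p in if Q n p then (U', V') else (U - U', V - V'))" for n p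
  define z where "z = rec_nat (C, D) nxt"
  have z: "z 0 = (C, D)" "z (Suc n) = nxt n (z n)" for n by (simp_all add: z_def)
  have "node (\<lambda>n. Q n (z n)) n = z n" for n
    by (induction n) (simp_all add: z nxt_def node.simps(2) Let_def split: prod.splits)
  then show ?thesis by (intro exI[of _ "\<lambda>n. Q n (z n)"]) simp
qed

lemma branch_through_fst: assumes "c \<in> C" obtains x where "\<And>n. c \<in> fst (node x n)"
proof -
  obtain x where x: "\<And>n. x n = (c \<in> fst (step n (node x n)))"
    using branch_by_rule[of "\<lambda>n p. c \<in> fst (step n p)"] by blast
  have "c \<in> fst (node x n)" for n
  proof (induction n)
    case (Suc n) then show ?case using x[of n] by (simp only: node_Suc_fst split: if_splits) auto
  qed (simp add: assms)
  then show thesis by (rule that)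
qed

lemma branch_through_snd: assumes "d \<in> D" obtains x where "\<And>n. d \<in> snd (node x n)"
proof -
  obtain x where x: "\<And>n. x n = (d \<in> snd (step n (node x n)))"
    using branch_by_rule[of "\<lambda>n p. d \<in> snd (step n p)"] by blast
  have "d \<in> snd (node x n)" for n
  proof (induction n)
    case (Suc n) then show ?case using x[of n] by (simp only: node_Suc_snd split: if_splits) auto
  qed (simp add: assms)
  then show thesis by (rule that)
qed

lemma node_decided:
  "even n \<Longrightarrow> X.decided (n div 2) (fst (node x (Suc n)))"
  "odd n \<Longrightarrow> Y.decided (n div 2) (snd (node x (Suc n)))"
  unfolding node_Suc_fst node_Suc_snd using good_step_node[of n x]
  by (auto simp: good_step_def split: prod.splits)

text \<open>Each generator is decided once every two levels.\<close>

lemma node_in_cell_fst: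
  assumes "c \<in> fst (node x n)" "2 * k \<le> n" shows "fst (node x n) \<subseteq> X.cell c k"
proof
  fix c' assume c': "c' \<in> fst (node x n)"
  have "c' \<in> B j \<longleftrightarrow> c \<in> B j" if "j < k" for j
  proof -
    have "X.decided j (fst (node x (Suc (2*j))))"
      using node_decided(1)[of "2*j" x] by simp
    moreover have "c \<in> fst (node x (Suc (2*j)))" "c' \<in> fst (node x (Suc (2*j)))"
      using node_antimono(1)[of "Suc (2*j)" n x] assms c' that by auto
    ultimately show ?thesis by (auto simp: X.decided_def)
  qed
  moreover have "c' \<in> C" using c' node_clopen(1) clopen_in_subset by blast
  ultimately show "c' \<in> X.cell c k" by (simp add: X.cell_def)
qed

lemma node_in_cell_snd:
  assumes "d \<in> snd (node x n)" "2 * k \<le> n" shows "snd (node x n) \<subseteq> Y.cell d k"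
proof
  fix d' assume d': "d' \<in> snd (node x n)"
  have "d' \<in> B' j \<longleftrightarrow> d \<in> B' j" if "j < k" for j
  proof -
    have "Y.decided j (snd (node x (Suc (Suc (2*j)))))"
      using node_decided(2)[of "Suc (2*j)" x] by simp
    moreover have "d \<in> snd (node x (Suc (Suc (2*j))))" "d' \<in> snd (node x (Suc (Suc (2*j))))"
      using node_antimono(2)[of "Suc (Suc (2*j))" n x] assms d' that by auto
    ultimately show ?thesis by (auto simp: Y.decided_def)
  qed
  moreover have "d' \<in> D" using d' node_clopen(3) clopen_in_subset by blast
  ultimately show "d' \<in> Y.cell d k" by (simp add: Y.cell_def)
qed

lemma branch_meets_fst: obtains c where "\<And>n. c \<in> fst (node x n)"
  by (rule nested_compact_meet[of "\<lambda>n. fst (node x n)"])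
     (use X.compact_clopen node_clopen(1,2) node_antimono in auto)

lemma branch_meets_snd: obtains c where "\<And>n. c \<in> snd (node x n)"
  by (rule nested_compact_meet[of "\<lambda>n. snd (node x n)"])
     (use Y.compact_clopen node_clopen(3,4) node_antimono in auto)

lemma branch_point_unique_fst:
  assumes "\<And>n. c \<in> fst (node x n)" "\<And>n. c' \<in> fst (node x n)" shows "c = c'"
proof (rule ccontr)
  assume "c \<noteq> c'"
  moreover have "c \<in> C" "c' \<in> C" using assms(1)[of 0] assms(2)[of 0] by simp_all
  ultimately obtain j where "(c \<in> B j) \<noteq> (c' \<in> B j)" using X.separated by blast
  moreover have "c' \<in> X.cell c (Suc j)"
    using node_in_cell_fst[of c x "2 * Suc j" "Suc j"] assms by blast
  ultimately show False by (simp add: X.cell_def)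
qed

lemma branch_point_unique_snd:
  assumes "\<And>n. d \<in> snd (node x n)" "\<And>n. d' \<in> snd (node x n)" shows "d = d'"
proof (rule ccontr)
  assume "d \<noteq> d'"
  moreover have "d \<in> D" "d' \<in> D" using assms(1)[of 0] assms(2)[of 0] by simp_all
  ultimately obtain j where "(d \<in> B' j) \<noteq> (d' \<in> B' j)" using Y.separated by blast
  moreover have "d' \<in> Y.cell d (Suc j)"
    using node_in_cell_snd[of d x "2 * Suc j" "Suc j"] assms by blast
  ultimately show False by (simp add: Y.cell_def)
qed

lemma peak_tendsto_fst:
  assumes "\<And>n. c \<in> fst (node x n)"
  shows "(\<lambda>n. X.peak (fst (node x n))) \<longlonglongrightarrow> \<phi> c"
proof (rule order_tendstoI)
  fix a assume "a < \<phi> c"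
  then show "\<forall>\<^sub>F n in sequentially. a < X.peak (fst (node x n))"
    using X.le_peak[OF node_clopen(1) assms] by (intro always_eventually allI) (meson less_le_trans)
next
  fix a assume "\<phi> c < a"
  moreover have "c \<in> C" using assms[of 0] by simp
  ultimately obtain k where k: "\<And>c'. c' \<in> X.cell c k \<Longrightarrow> \<phi> c' < a"
    using X.upper_semicontinuous by metis
  have "X.peak (fst (node x n)) < a" if "n \<ge> 2 * k" for n
    by (metis X.peak_attained assms k node_clopen(1,2) node_in_cell_fst subsetD that)
  then show "\<forall>\<^sub>F n in sequentially. X.peak (fst (node x n)) < a"
    unfolding eventually_sequentially by blast
qed

lemma peak_tendsto_snd:
  assumes "\<And>n. d \<in> snd (node x n)"
  shows "(\<lambda>n. Y.peak (snd (node x n))) \<longlonglongrightarrow> \<psi> d"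
proof (rule order_tendstoI)
  fix a assume "a < \<psi> d"
  then show "\<forall>\<^sub>F n in sequentially. a < Y.peak (snd (node x n))"
    using Y.le_peak[OF node_clopen(3) assms] by (intro always_eventually allI) (meson less_le_trans)
next
  fix a assume "\<psi> d < a"
  moreover have "d \<in> D" using assms[of 0] by simp
  ultimately obtain k where k: "\<And>c'. c' \<in> Y.cell d k \<Longrightarrow> \<psi> c' < a"
    using Y.upper_semicontinuous by metis
  have "Y.peak (snd (node x n)) < a" if "n \<ge> 2 * k" for n
    by (metis Y.peak_attained assms k node_clopen(3,4) node_in_cell_snd subsetD that)
  then show "\<forall>\<^sub>F n in sequentially. Y.peak (snd (node x n)) < a"
    unfolding eventually_sequentially by blast
qed

definition node_gap :: "(nat \<Rightarrow> bool) \<Rightarrow> nat \<Rightarrow> real" where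
  "node_gap x n = gap (fst (node x n)) (snd (node x n))"

lemma node_gap_step: "\<bar>node_gap x (Suc n) - node_gap x n\<bar> < (1/2)^n"
  using good_step_node[of n x] unfolding node_gap_def node_Suc_fst node_Suc_snd good_step_def
  by (auto split: prod.splits)

text \<open>A geometric series bounds the total change of the gap beyond level \<open>n\<close>.\<close>

lemma node_gap_limit:
  obtains b where "node_gap x \<longlonglongrightarrow> b" "\<And>n. \<bar>b - node_gap x n\<bar> \<le> 2 * (1/2)^n"
proof -
  have near: "\<bar>node_gap x (n + k) - node_gap x n\<bar> \<le> 2 * (1/2)^n - 2 * (1/2)^(n+k)" for n k
  proof (induction k)
    case (Suc k)
    have "(1/2::real) ^ (n + Suc k) = (1/2)^(n+k) / 2" by simp
    then show ?case using node_gap_step[of x "n+k"] Suc unfolding add_Suc_right by linarith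
  qed simp
  have near': "\<bar>node_gap x m - node_gap x n\<bar> \<le> 2 * (1/2)^n" if "n \<le> m" for m n
  proof -
    have "(0::real) < (1/2)^m" by simp
    then show ?thesis using near[of n "m - n"] unfolding le_add_diff_inverse[OF that] by linarith
  qed
  have "Cauchy (node_gap x)"
  proof (rule metric_CauchyI)
    fix e :: real assume "0 < e"
    then obtain N where N: "(1/2::real)^N < e/4" using real_arch_pow_inv[of "e/4" "1/2"] by auto
    have "dist (node_gap x m) (node_gap x n) < e" if "m \<ge> N" "n \<ge> N" for m n
      using near'[OF that(1)] near'[OF that(2)] N unfolding dist_real_def by linarith
    then show "\<exists>M. \<forall>m\<ge>M. \<forall>n\<ge>M. dist (node_gap x m) (node_gap x n) < e" by blast
  qed
  then obtain b where b: "node_gap x \<longlonglongrightarrow> b" using Cauchy_convergent convergent_def by blast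
  have "\<bar>b - node_gap x n\<bar> \<le> 2 * (1/2)^n" for n
  proof (rule LIMSEQ_le_const2)
    show "(\<lambda>m. \<bar>node_gap x m - node_gap x n\<bar>) \<longlonglongrightarrow> \<bar>b - node_gap x n\<bar>"
      by (intro tendsto_intros b)
  qed (use near' in blast)
  with b show thesis by (rule that)
qed

text \<open>Points on the same branch correspond under \<open>h\<close>, and \<open>\<alpha>\<close> is the exponential of the limit of the gaps
  along that branch.  Since peaks converge to values of the functions along a branch, the relation
  between the peaks of paired sets passes to the limit.\<close>

theorem lelek_functions_equivalent:
  obtains h \<alpha> where "continuous_on C h" "h ` C = D" "inj_on h C" "continuous_on C \<alpha>"
    "\<And>c. c \<in> C \<Longrightarrow> 0 < \<alpha> c" "\<And>c. c \<in> C \<Longrightarrow> \<psi> (h c) = \<alpha> c * \<phi> c"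
proof -
  obtain br where br: "\<And>c n. c \<in> C \<Longrightarrow> c \<in> fst (node (br c) n)"
  proof -
    have "\<exists>x. \<forall>n. c \<in> fst (node x n)" if "c \<in> C" for c by (meson branch_through_fst that)
    then show thesis using that by metis
  qed
  obtain pt where pt: "\<And>x n. pt x \<in> snd (node x n)"
  proof -
    have "\<exists>d. \<forall>n. d \<in> snd (node x n)" for x by (meson branch_meets_snd)
    then show thesis using that by metis
  qed
  obtain lim where lim: "\<And>x. node_gap x \<longlonglongrightarrow> lim x" "\<And>x n. \<bar>lim x - node_gap x n\<bar> \<le> 2 * (1/2)^n"
  proof -
    have "\<exists>b. node_gap x \<longlonglongrightarrow> b \<and> (\<forall>n. \<bar>b - node_gap x n\<bar> \<le> 2 * (1/2)^n)" for x
      by (meson node_gap_limit)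
    then show thesis using that by metis
  qed
  define h where "h c = pt (br c)" for c
  define \<alpha> where "\<alpha> c = exp (lim (br c))" for c
  have h: "h c \<in> snd (node (br c) n)" for c n by (simp add: h_def pt)
  \<comment> \<open>the sets of level \<open>n\<close> are relatively open, so nearby points share their branch up to level \<open>n\<close>\<close>
  have near: "\<exists>A. open A \<and> c \<in> A \<and> (\<forall>c'\<in>C. c' \<in> A \<longrightarrow> node (br c') n = node (br c) n)"
    if c: "c \<in> C" for c n
  proof -
    obtain T where T: "open T" "fst (node (br c) n) = C \<inter> T"
      using node_clopen(1) unfolding clopen_in_def openin_open by blast
    have "node (br c') n = node (br c) n" if "c' \<in> C" "c' \<in> T" for c'
    proof (rule node_disjoint_fst[of c'])
      show "c' \<in> fst (node (br c') n)" using br that(1) by blast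
      show "c' \<in> fst (node (br c) n)" using T(2) that by blast
    qed
    moreover have "c \<in> T" using br[OF c, of n] T(2) by blast
    ultimately show ?thesis using T(1) by blast
  qed
  show thesis
  proof
    show "continuous_on C h" unfolding continuous_on_topological
    proof (intro ballI allI impI)
      fix c O' assume c: "c \<in> C" and O': "open O'" "h c \<in> O'"
      have "h c \<in> D" using h[of c 0] by simp
      have "compact (D - O')" using Y.compact_base O' compact_diff by blast
      moreover have "D - O' \<subseteq> D" "h c \<notin> D - O'" using O'(2) by auto
      ultimately obtain k where k: "Y.cell (h c) k \<inter> (D - O') = {}"
        using Y.cell_avoids_compact[OF _ _ \<open>h c \<in> D\<close>] by metis
      obtain A where A: "open A" "c \<in> A" "\<And>c'. c' \<in> C \<Longrightarrow> c' \<in> A \<Longrightarrow> node (br c') (2*k) = node (br c) (2*k)"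
        using near[OF c, of "2*k"] by blast
      have "h c' \<in> O'" if "c' \<in> C" "c' \<in> A" for c'
      proof -
        have "h c' \<in> snd (node (br c) (2*k))" using A(3)[OF that] h[of c' "2*k"] by simp
        then have "h c' \<in> Y.cell (h c) k" using node_in_cell_snd[OF h] by blast
        then show ?thesis using k by (auto simp: Y.cell_def)
      qed
      then show "\<exists>A. open A \<and> c \<in> A \<and> (\<forall>y\<in>C. y \<in> A \<longrightarrow> h y \<in> O')" using A by blast
    qed
    have "continuous_on C (\<lambda>c. lim (br c))" unfolding continuous_on_topological
    proof (intro ballI allI impI)
      fix c O' assume c: "c \<in> C" and O': "open O'" "lim (br c) \<in> O'"
      then obtain e where e: "e > 0" "\<And>y. \<bar>y - lim (br c)\<bar> < e \<Longrightarrow> y \<in> O'"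
        unfolding open_dist dist_real_def by blast
      obtain n where n: "(1/2::real)^n < e/4" using real_arch_pow_inv[of "e/4" "1/2"] e by auto
      obtain A where A: "open A" "c \<in> A" "\<And>c'. c' \<in> C \<Longrightarrow> c' \<in> A \<Longrightarrow> node (br c') n = node (br c) n"
        using near[OF c, of n] by blast
      have "lim (br c') \<in> O'" if "c' \<in> C" "c' \<in> A" for c'
      proof (rule e(2))
        have "node_gap (br c') n = node_gap (br c) n" using A(3)[OF that] by (simp add: node_gap_def)
        then show "\<bar>lim (br c') - lim (br c)\<bar> < e"
          using lim(2)[of "br c'" n] lim(2)[of "br c" n] n by linarith
      qed
      then show "\<exists>A. open A \<and> c \<in> A \<and> (\<forall>y\<in>C. y \<in> A \<longrightarrow> lim (br y) \<in> O')" using A by blast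
    qed
    then show "continuous_on C \<alpha>" unfolding \<alpha>_def by (intro continuous_intros)
    show "h ` C = D"
    proof
      show "h ` C \<subseteq> D" using h[of _ 0] by auto
      show "D \<subseteq> h ` C"
      proof
        fix d assume "d \<in> D"
        then obtain x where x: "\<And>n. d \<in> snd (node x n)" using branch_through_snd by metis
        obtain c where c: "\<And>n. c \<in> fst (node x n)" using branch_meets_fst by metis
        have "c \<in> C" using c[of 0] by simp
        have "h c = d"
        proof (rule branch_point_unique_snd[OF _ x])
          show "h c \<in> snd (node x n)" for n
            using h[of c n] node_disjoint_fst[OF br[OF \<open>c \<in> C\<close>, of n] c[of n]] by simp
        qed
        then show "d \<in> h ` C" using \<open>c \<in> C\<close> by blast
      qed
    qed
    show "inj_on h C"
    proof (rule inj_onI)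
      fix c c' assume c: "c \<in> C" "c' \<in> C" and eq: "h c = h c'"
      have "c' \<in> fst (node (br c) n)" for n
        using br[OF c(2), of n] node_disjoint_snd[OF h[of c n], of "br c'"] h[of c' n] eq by simp
      with br[OF c(1)] show "c = c'" by (rule branch_point_unique_fst)
    qed
    fix c assume c: "c \<in> C"
    show "0 < \<alpha> c" by (simp add: \<alpha>_def)
    let ?x = "br c"
    have "exp (node_gap ?x n) * X.peak (fst (node ?x n)) = Y.peak (snd (node ?x n))" for n
      using X.peak_pos[OF node_clopen(1,2)[of ?x n]] Y.peak_pos[OF node_clopen(3,4)[of ?x n]]
      by (simp add: node_gap_def gap_def exp_diff)
    then have "(\<lambda>n. exp (node_gap ?x n) * X.peak (fst (node ?x n))) \<longlonglongrightarrow> \<psi> (h c)"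
      using peak_tendsto_snd[OF h, of c] by simp
    moreover have "(\<lambda>n. exp (node_gap ?x n) * X.peak (fst (node ?x n))) \<longlonglongrightarrow> \<alpha> c * \<phi> c"
      unfolding \<alpha>_def by (intro tendsto_intros lim peak_tendsto_fst br c)
    ultimately show "\<psi> (h c) = \<alpha> c * \<phi> c" by (rule LIMSEQ_unique)
  qed
qed

text \<open>Stretching the leg over \<open>c\<close> by \<open>\<alpha> c\<close> and placing it over \<open>h c\<close> maps one body bijectively onto the other,
  so a fan charted over one Lelek function is charted over every other one.  This is the
  uniqueness of the Lelek fan in the form needed below.\<close>

lemma fan_chart_transfer:
  assumes chart: "fan_chart D \<psi> \<pi> L"
  obtains \<pi>' where "fan_chart C \<phi> \<pi>' L"
proof -
  obtain h \<alpha> where h: "continuous_on C h" "h ` C = D" "inj_on h C" and \<alpha>: "continuous_on C \<alpha>"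
    and pos: "\<And>c. c \<in> C \<Longrightarrow> 0 < \<alpha> c" and eq: "\<And>c. c \<in> C \<Longrightarrow> \<psi> (h c) = \<alpha> c * \<phi> c"
    using lelek_functions_equivalent by metis
  let ?E = "fan_body C \<phi>" and ?E' = "fan_body D \<psi>"
  define G where "G = (\<lambda>p. (h (fst p), \<alpha> (fst p) * snd p))"
  have fst: "fst ` ?E \<subseteq> C" by (auto simp: fan_body_def)
  have fst_cont: "continuous_on ?E fst"
    using continuous_on_fst[OF continuous_on_id] by blast
  have "continuous_on ?E (\<lambda>p. h (fst p))" by (rule continuous_on_compose2[OF h(1) fst_cont fst])
  moreover have "continuous_on ?E (\<lambda>p. \<alpha> (fst p))"
    by (rule continuous_on_compose2[OF \<alpha> fst_cont fst])
  then have "continuous_on ?E (\<lambda>p. \<alpha> (fst p) * snd p)"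
    by (rule continuous_on_mult[OF _ continuous_on_snd[OF continuous_on_id]])
  ultimately have contG: "continuous_on ?E G" unfolding G_def by (rule continuous_on_Pair)
  have img: "G ` ?E = ?E'"
  proof
    show "G ` ?E \<subseteq> ?E'"
    proof
      fix q assume "q \<in> G ` ?E"
      then obtain c t where ct: "(c, t) \<in> ?E" "q = (h c, \<alpha> c * t)" by (auto simp: G_def)
      then have "c \<in> C" "0 \<le> t" "t \<le> \<phi> c" by simp_all
      then show "q \<in> ?E'"
        using h(2) pos[of c] eq[of c] ct(2) by (auto intro: mult_left_mono)
    qed
    show "?E' \<subseteq> G ` ?E"
    proof
      fix p assume "p \<in> ?E'"
      then obtain d s where p: "p = (d, s)" "d \<in> D" "0 \<le> s" "s \<le> \<psi> d" by (auto simp: fan_body_def)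
      then obtain c where c: "c \<in> C" "d = h c" using h(2) by blast
      then have "(c, s / \<alpha> c) \<in> ?E" "G (c, s / \<alpha> c) = p"
        using p pos[of c] eq[of c] by (simp_all add: G_def field_simps)
      then show "p \<in> G ` ?E" by (metis imageI)
    qed
  qed
  have inj: "G p = G q \<longleftrightarrow> p = q" "snd (G p) = 0 \<longleftrightarrow> snd p = 0" if "p \<in> ?E" "q \<in> ?E" for p q
  proof -
    have "fst p \<in> C" "fst q \<in> C" using that fst by auto
    then have "\<alpha> (fst p) \<noteq> 0" and "h (fst p) = h (fst q) \<longleftrightarrow> fst p = fst q"
      using pos[of "fst p"] inj_on_eq_iff[OF h(3)] by auto
    then show "G p = G q \<longleftrightarrow> p = q" "snd (G p) = 0 \<longleftrightarrow> snd p = 0"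
      by (auto simp: G_def prod_eq_iff)
  qed
  show thesis
  proof
    show "fan_chart C \<phi> (\<pi> \<circ> G) L" unfolding fan_chart_def
    proof (intro conjI ballI)
      show "continuous_on ?E (\<pi> \<circ> G)"
        using chart contG img by (intro continuous_on_compose) (auto simp: fan_chart_def)
      show "(\<pi> \<circ> G) ` ?E = L" using chart img by (metis fan_chart_def image_comp)
      fix p q assume pq: "p \<in> ?E" "q \<in> ?E"
      then have "G p \<in> ?E'" "G q \<in> ?E'" using img by auto
      then have "\<pi> (G p) = \<pi> (G q) \<longleftrightarrow> G p = G q \<or> snd (G p) = 0 \<and> snd (G q) = 0"
        using chart by (auto simp: fan_chart_def)
      then show "(\<pi> \<circ> G) p = (\<pi> \<circ> G) q \<longleftrightarrow> p = q \<or> snd p = 0 \<and> snd q = 0"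
        using inj pq by (metis comp_apply)
    qed
  qed
qed

end

section \<open>Every Lelek fan is the fan of a Lelek function\<close>

text \<open>The first digit of the expansion decides between the two copies; dropping it rescales by 3.\<close>

lemma ternary_self_similar:
  assumes "x \<in> ternary_cantor_set"
  shows "0 \<le> x" "x \<le> 1" "x \<le> 1/3 \<and> 3 * x \<in> ternary_cantor_set \<or> 2/3 \<le> x \<and> 3 * x - 2 \<in> ternary_cantor_set"
proof -
  define d :: "(nat \<Rightarrow> bool) \<Rightarrow> nat \<Rightarrow> real" where "d a n = (if a n then 2 else 0) / 3 ^ Suc n" for a n
  have T: "ternary_cantor_set = range (\<lambda>a. suminf (d a))"
    by (simp add: ternary_cantor_set_def d_def[abs_def])
  have geo: "(\<lambda>n. 2/3 * (1/3::real) ^ n) sums 1"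
    using sums_mult[OF geometric_sums[of "1/3::real"], of "2/3"] by simp
  have dn: "0 \<le> d a n" "d a n \<le> 2/3 * (1/3) ^ n" for a n
    by (simp_all add: d_def power_divide)
  have summ: "summable (d a)" for a
    by (rule summable_comparison_test[OF _ sums_summable[OF geo]]) (use dn in auto)
  have rng: "0 \<le> suminf (d a)" "suminf (d a) \<le> 1" for a
  proof -
    show "0 \<le> suminf (d a)" by (rule suminf_nonneg[OF summ]) (rule dn)
    show "suminf (d a) \<le> 1"
      using suminf_le[of "d a", OF _ summ sums_summable[OF geo]] dn sums_unique[OF geo] by simp
  qed
  have split: "3 * suminf (d a) = (if a 0 then 2 else 0) + suminf (d (\<lambda>n. a (Suc n)))" for a
  proof -
    have "suminf (d a) = d a 0 + (\<Sum>n. d a (Suc n))"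
      using suminf_split_head[OF summ[of a]] by simp
    also have "(\<lambda>n. d a (Suc n)) = (\<lambda>n. d (\<lambda>n. a (Suc n)) n / 3)" by (auto simp: d_def)
    also have "(\<Sum>n. d (\<lambda>n. a (Suc n)) n / 3) = suminf (d (\<lambda>n. a (Suc n))) / 3"
      by (rule suminf_divide[OF summ])
    finally have "suminf (d a) = d a 0 + suminf (d (\<lambda>n. a (Suc n))) / 3" .
    moreover have "d a 0 = (if a 0 then 2 else 0) / 3" by (simp add: d_def)
    ultimately show ?thesis by simp
  qed
  obtain a where a: "x = suminf (d a)" using assms T by auto
  have mem: "suminf (d (\<lambda>n. a (Suc n))) \<in> ternary_cantor_set" by (simp add: T)
  show "0 \<le> x" "x \<le> 1" using rng a by auto
  show "x \<le> 1/3 \<and> 3 * x \<in> ternary_cantor_set \<or> 2/3 \<le> x \<and> 3 * x - 2 \<in> ternary_cantor_set"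
  proof (cases "a 0")
    case True
    then have "3 * x - 2 = suminf (d (\<lambda>n. a (Suc n)))" using split[of a] a by simp
    then show ?thesis using mem rng(1)[of "\<lambda>n. a (Suc n)"] by (intro disjI2) auto
  next
    case False
    then have "3 * x = suminf (d (\<lambda>n. a (Suc n)))" using split[of a] a by simp
    then show ?thesis using mem rng(2)[of "\<lambda>n. a (Suc n)"] by (intro disjI1) auto
  qed
qed

text \<open>An interval inside the set avoids the middle third, hence lies in one of the two copies, and
  rescaling triples its length; but no interval in the set is longer than 1.\<close>

lemma ternary_cantor_set_no_interval:
  assumes "{a..b} \<subseteq> ternary_cantor_set"
  shows "b \<le> a"
proof (rule ccontr)
  assume "\<not> b \<le> a"
  have "a \<le> b \<Longrightarrow> {a..b} \<subseteq> ternary_cantor_set \<Longrightarrow> b - a \<le> (1/3) ^ n" for a b and n :: nat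
  proof (induction n arbitrary: a b)
    case 0
    then have "a \<in> ternary_cantor_set" "b \<in> ternary_cantor_set" by auto
    then show ?case using ternary_self_similar(1)[of a] ternary_self_similar(2)[of b] by simp
  next
    case (Suc n)
    then have ab: "a \<in> ternary_cantor_set" "b \<in> ternary_cantor_set" by auto
    show ?case
    proof (cases "b < 2/3")
      case True
      have "{3*a..3*b} \<subseteq> ternary_cantor_set"
      proof
        fix y assume "y \<in> {3*a..3*b}"
        then have "y/3 \<in> ternary_cantor_set" "y/3 < 2/3" using Suc.prems True by auto
        then show "y \<in> ternary_cantor_set" using ternary_self_similar(3)[of "y/3"] by auto
      qed
      from Suc.IH[OF _ this] show ?thesis using Suc.prems by simp
    next
      case False
      have "1/3 < a"
      proof (rule ccontr)
        assume "\<not> 1/3 < a"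
        then have "1/2 \<in> ternary_cantor_set" using False Suc.prems(2) by auto
        then show False using ternary_self_similar(3)[of "1/2"] by simp
      qed
      have "{3*a-2..3*b-2} \<subseteq> ternary_cantor_set"
      proof
        fix y assume "y \<in> {3*a-2..3*b-2}"
        then have "(y+2)/3 \<in> {a..b}" by (simp add: field_simps)
        then have "(y+2)/3 \<in> ternary_cantor_set" "1/3 < (y+2)/3" 
          using Suc.prems(2) \<open>1/3 < a\<close> by auto
        moreover have "3 * ((y+2)/3) - 2 = y" by (simp add: field_simps)
        ultimately show "y \<in> ternary_cantor_set" using ternary_self_similar(3)[of "(y+2)/3"]
          by (metis not_le)
      qed
      from Suc.IH[OF _ this] show ?thesis using Suc.prems by simp
    qed
  qed
  from this[of a b] have "b - a \<le> (1/3) ^ n" for n using assms \<open>\<not> b \<le> a\<close> by auto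
  moreover obtain n where "(1/3::real) ^ n < b - a"
    using real_arch_pow_inv[of "b - a" "1/3"] \<open>\<not> b \<le> a\<close> by auto
  ultimately show False by (meson not_less)
qed

lemma cantor_set_gap:
  fixes K :: "real set"
  assumes "cantor_set K" "x < y"
  obtains z where "x < z" "z < y" "z \<notin> K"
proof (rule ccontr)
  assume "\<not> thesis"
  then have all: "\<And>z. x < z \<Longrightarrow> z < y \<Longrightarrow> z \<in> K" using that by blast
  obtain g k where gk: "homeomorphism K ternary_cantor_set g k"
    using assms(1) unfolding cantor_set_def homeomorphic_def by blast
  define u v where "u = x + (y - x) / 3" and "v = x + 2 * (y - x) / 3"
  have uv: "x < u" "u < v" "v < y" using \<open>x < y\<close> by (auto simp: u_def v_def field_simps)
  have sub: "{u..v} \<subseteq> K" using all uv by auto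
  have "continuous_on {u..v} g" using gk sub by (meson continuous_on_subset homeomorphism_cont1)
  then have con: "connected (g ` {u..v})" by (intro connected_continuous_image) auto
  have T: "g ` {u..v} \<subseteq> ternary_cantor_set" using gk sub by (metis homeomorphism_image1 image_mono)
  have le: "q \<le> p" if "p \<in> g ` {u..v}" "q \<in> g ` {u..v}" for p q
  proof (rule ternary_cantor_set_no_interval)
    show "{p..q} \<subseteq> ternary_cantor_set" using connected_contains_Icc[OF con that] T by blast
  qed
  have "u \<in> {u..v}" "v \<in> {u..v}" using uv by auto
  then have "g u = g v" using le by (meson antisym imageI)
  then have "u = v" using gk sub \<open>u \<in> {u..v}\<close> \<open>v \<in> {u..v}\<close> by (metis homeomorphism_apply1 subsetD)
  then show False using uv by simp
qed

definition ray :: "real \<Rightarrow> real \<Rightarrow> real \<times> real" where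
  "ray c t = (t * c, - t)"

lemma ray_eq_iff: "ray c t = ray c' t' \<longleftrightarrow> t = t' \<and> (t = 0 \<or> c = c')"
  by (auto simp: ray_def)

lemma planar_fan_eq: "planar_fan K = {ray c t |c t. c \<in> K \<and> 0 \<le> t \<and> t \<le> 1}"
  by (fastforce simp: planar_fan_def ray_def in_segment)

lemma continuous_ray: "continuous_on S (\<lambda>p. ray (fst p) (snd p))"
  unfolding ray_def by (intro continuous_intros)

text \<open>The homeomorphic image of a segment of the leg is an arc through the point, which is neither
  of its ends.\<close>

lemma interior_of_leg_not_endpoint:
  assumes k: "continuous_on M k" "inj_on k M"
    and leg: "\<And>u. a \<le> u \<Longrightarrow> u \<le> b \<Longrightarrow> ray c u \<in> M" and t: "a < t" "t < b"
  shows "k (ray c t) \<notin> fan_endpoints (k ` M)"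
proof
  assume "k (ray c t) \<in> fan_endpoints (k ` M)"
  let ?l = "linepath (ray c a) (ray c b)"
  have seg: "closed_segment (ray c a) (ray c b) = ray c ` {a..b}"
  proof -
    have "linear (\<lambda>u. ray c u)" by (intro linearI) (auto simp: ray_def algebra_simps)
    then have "ray c ` closed_segment a b = closed_segment (ray c a) (ray c b)"
      by (rule closed_segment_linear_image[symmetric])
    then show ?thesis using t by (simp add: closed_segment_eq_real_ivl)
  qed
  then have subM: "path_image ?l \<subseteq> M" using leg by auto
  have "ray c a \<noteq> ray c b" using t by (simp add: ray_eq_iff)
  then have "inj_on ?l {0..1}" by (rule inj_on_linepath)
  have arc: "arc (k \<circ> ?l)" unfolding arc_def
  proof
    show "path (k \<circ> ?l)" by (intro path_continuous_image path_linepath continuous_on_subset[OF k(1) subM])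
    show "inj_on (k \<circ> ?l) {0..1}"
      using \<open>inj_on ?l {0..1}\<close> k(2) subM unfolding path_image_def by (meson comp_inj_on inj_on_subset)
  qed
  have "path_image (k \<circ> ?l) \<subseteq> k ` M" "k (ray c t) \<in> path_image (k \<circ> ?l)"
    using subM seg t by (auto simp: path_image_compose)
  then have "k (ray c t) = pathstart (k \<circ> ?l) \<or> k (ray c t) = pathfinish (k \<circ> ?l)"
    using \<open>k (ray c t) \<in> fan_endpoints (k ` M)\<close> arc unfolding fan_endpoints_def by blast
  then have "k (ray c t) = k (ray c a) \<or> k (ray c t) = k (ray c b)"
    by (simp add: pathstart_compose pathfinish_compose)
  moreover have "ray c t \<in> M" "ray c a \<in> M" "ray c b \<in> M" using leg t by auto
  ultimately have "ray c t = ray c a \<or> ray c t = ray c b" using inj_onD[OF k(2)] by metis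
  then show False using t by (simp add: ray_eq_iff)
qed

lemma dense_subset_meets:
  assumes "closure D = L" "continuous_on L g" "open W" "p \<in> L" "g p \<in> W"
  obtains e where "e \<in> D" "g e \<in> W"
proof -
  have "openin (top_of_set L) (L \<inter> g -` W)" using assms by (intro continuous_openin_preimage_gen)
  then obtain T where T: "open T" "L \<inter> g -` W = L \<inter> T" unfolding openin_open by blast
  then have "p \<in> T \<inter> closure D" using assms by auto
  then have "T \<inter> D \<noteq> {}" using open_Int_closure_eq_empty[OF T(1), of D] by blast
  then obtain e where "e \<in> T" "e \<in> D" by blast
  then have "e \<in> L \<inter> T" using assms(1) closure_subset by blast
  then have "g e \<in> W" using T(2) by blast
  with \<open>e \<in> D\<close> show thesis by (rule that)
qed

text \<open>\<open>M\<close> is the copy in the plane of a Lelek fan \<open>k ` M\<close>, which lives in an arbitrary metric space.\<close>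

context
  fixes K :: "real set" and M :: "(real \<times> real) set" and k :: "real \<times> real \<Rightarrow> 'a::metric_space"
    and g :: "'a \<Rightarrow> real \<times> real"
  assumes K: "cantor_set K" "compact K" and M: "M \<subseteq> planar_fan K" "compact M" "connected M"
    and hom: "homeomorphism M (k ` M) k g"
    and nontrivial: "\<exists>p\<in>M. \<exists>q\<in>M. p \<noteq> q"
    and dense: "closure (fan_endpoints (k ` M)) = k ` M"
begin

lemma gk: "p \<in> M \<Longrightarrow> g (k p) = p"
  by (rule homeomorphism_apply1[OF hom])

lemma k_cont: "continuous_on M k"
  by (rule homeomorphism_cont1[OF hom])

lemma g_cont: "continuous_on (k ` M) g"
  by (rule homeomorphism_cont2[OF hom])

lemma k_inj: "inj_on k M"
  using gk by (rule inj_on_inverseI)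

lemma point_cases:
  assumes "p \<in> M" obtains c t where "c \<in> K" "0 \<le> t" "t \<le> 1" "p = ray c t"
  using assms M(1) unfolding planar_fan_eq by blast

lemma ray_mem: "ray c t \<in> M \<Longrightarrow> 0 \<le> t \<and> t \<le> 1 \<and> (t \<noteq> 0 \<longrightarrow> c \<in> K)"
  using M(1) unfolding planar_fan_eq by (auto simp: ray_eq_iff)

text \<open>Without the apex, \<open>M\<close> projects continuously to \<open>K\<close>; as \<open>K\<close> contains no interval, \<open>M\<close> is a segment of a
  single leg.  Its interior points then form a non-empty open set without end-points.\<close>

lemma apex_mem: "(0, 0) \<in> M"
proof (rule ccontr)
  assume "(0, 0) \<notin> M"
  have neg: "snd p < 0" if "p \<in> M" for p
  proof -
    obtain c t where "0 \<le> t" "p = ray c t" using point_cases[OF \<open>p \<in> M\<close>] by metis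
    moreover have "t \<noteq> 0" using \<open>(0, 0) \<notin> M\<close> \<open>p \<in> M\<close> calculation by (auto simp: ray_def)
    ultimately show ?thesis by (simp add: ray_def)
  qed
  define base where "base p = fst p / - snd p" for p :: "real \<times> real"
  have base: "base p \<in> K" "p = ray (base p) (- snd p)" if "p \<in> M" for p
  proof -
    obtain c t where p: "c \<in> K" "p = ray c t" using point_cases[OF \<open>p \<in> M\<close>] by metis
    then have "0 < t" using neg[OF that] by (simp add: ray_def)
    then have "base p = c" using p by (simp add: base_def ray_def)
    then show "base p \<in> K" "p = ray (base p) (- snd p)" using p by (simp_all add: ray_def)
  qed
  have "continuous_on M base" unfolding base_def using neg
    by (intro continuous_on_divide continuous_on_fst continuous_on_minus continuous_on_snd continuous_on_id) force
  then have con: "connected (base ` M)" using M(3) by (rule connected_continuous_image)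
  have le: "base q \<le> base p" if "p \<in> M" "q \<in> M" for p q
  proof (rule ccontr)
    assume "\<not> base q \<le> base p"
    then obtain z where z: "base p < z" "z < base q" "z \<notin> K"
      using cantor_set_gap[OF K(1), of "base p" "base q"] by auto
    then have "z \<in> base ` M" using connected_contains_Icc[OF con imageI[OF that(1)] imageI[OF that(2)]] by auto
    then show False using base(1) z(3) by blast
  qed
  obtain p0 where p0: "p0 \<in> M" using nontrivial by blast
  define c where "c = base p0"
  have eq: "p = ray c (- snd p)" if "p \<in> M" for p
    using base(2)[OF that] le[OF that p0] le[OF p0 that] by (simp add: c_def)
  have "connected (snd ` M)"
    using M(3) by (intro connected_continuous_image continuous_on_snd continuous_on_id)
  note icc = connected_contains_Icc[OF this]
  obtain p q where pq: "p \<in> M" "q \<in> M" "snd p < snd q"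
  proof -
    obtain p q where "p \<in> M" "q \<in> M" "p \<noteq> q" using nontrivial by blast
    moreover have "snd p \<noteq> snd q" using eq[of p] eq[of q] calculation by metis
    ultimately show thesis using that by (metis linorder_neqE_linordered_idom)
  qed
  have leg: "ray c u \<in> M" if "- snd q \<le> u" "u \<le> - snd p" for u
  proof -
    have "- u \<in> snd ` M" using icc[of "snd p" "snd q"] pq that by auto
    then obtain r where "r \<in> M" "- u = snd r" by blast
    moreover from this have "- snd r = u" by simp
    ultimately show ?thesis using eq[of r] by metis
  qed
  define m where "m = - (snd p + snd q) / 2"
  have m: "- snd q < m" "m < - snd p" using pq by (auto simp: m_def)
  have "open {r :: real \<times> real. snd p < snd r \<and> snd r < snd q}"
    by (intro open_Collect_conj open_Collect_less continuous_on_const continuous_on_snd continuous_on_id)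
  moreover have "ray c m \<in> M" using leg m by simp
  moreover have "g (k (ray c m)) \<in> {r. snd p < snd r \<and> snd r < snd q}"
    using m gk[OF \<open>ray c m \<in> M\<close>] by (simp add: ray_def)
  ultimately obtain e where e: "e \<in> fan_endpoints (k ` M)" "snd p < snd (g e)" "snd (g e) < snd q"
    using dense_subset_meets[OF dense g_cont, of "{r. snd p < snd r \<and> snd r < snd q}" "k (ray c m)"] by auto
  then obtain r where r: "r \<in> M" "e = k r" by (auto simp: fan_endpoints_def)
  have "e \<notin> fan_endpoints (k ` M)"
    using interior_of_leg_not_endpoint[OF k_cont k_inj leg, of "- snd q" "- snd p" "- snd r"] e r gk[OF r(1)] eq[OF r(1)]
    by simp
  then show False using e by blast
qed

text \<open>If the point at height \<open>s\<close> were missing, compactness of \<open>M\<close> and two gaps of \<open>K\<close> around \<open>c\<close> would give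
  a window of legs none of which meets \<open>M\<close> at height \<open>s\<close>.  The part of \<open>M\<close> above that height in the window
  is then open and closed in \<open>M\<close>, contains the given point and omits the apex.\<close>

lemma leg_downward_closed:
  assumes "ray c t \<in> M" "0 \<le> s" "s \<le> t" shows "ray c s \<in> M"
proof (cases "s = 0 \<or> s = t")
  case True then show ?thesis using assms apex_mem by (auto simp: ray_def)
next
  case False
  then have st: "0 < s" "s < t" using assms by auto
  show ?thesis
  proof (rule ccontr)
    assume no: "ray c s \<notin> M"
    have "closed {x. ray x s \<in> M}"
    proof -
      have "continuous_on UNIV (\<lambda>x. ray x s)" unfolding ray_def by (intro continuous_intros)
      then have "closed ((\<lambda>x. ray x s) -` M)"
        using closed_vimage compact_imp_closed[OF M(2)] by blast
      then show ?thesis by (simp add: vimage_def)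
    qed
    then have "open (- {x. ray x s \<in> M})" by (rule open_Compl)
    moreover have "c \<in> - {x. ray x s \<in> M}" using no by simp
    ultimately obtain e where e: "0 < e" "\<And>x. \<bar>x - c\<bar> < e \<Longrightarrow> ray x s \<notin> M"
      unfolding open_dist dist_real_def by blast
    obtain u where u: "c - e < u" "u < c" "u \<notin> K" using cantor_set_gap[OF K(1), of "c - e" c] e(1) by auto
    obtain v where v: "c < v" "v < c + e" "v \<notin> K" using cantor_set_gap[OF K(1), of c "c + e"] e(1) by auto
    define W where "W = {p \<in> M. s < - snd p \<and> u * - snd p < fst p \<and> fst p < v * - snd p}"
    have "openin (top_of_set M) W"
    proof -
      have "open {p :: real \<times> real. s < - snd p \<and> u * - snd p < fst p \<and> fst p < v * - snd p}"
        by (intro open_Collect_conj open_Collect_less continuous_intros)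
      moreover have "W = M \<inter> {p. s < - snd p \<and> u * - snd p < fst p \<and> fst p < v * - snd p}"
        by (auto simp: W_def)
      ultimately show ?thesis by (simp add: openin_open_Int)
    qed
    moreover have "closedin (top_of_set M) W"
    proof -
      have "closed {p :: real \<times> real. s \<le> - snd p \<and> u * - snd p \<le> fst p \<and> fst p \<le> v * - snd p}"
        by (intro closed_Collect_conj closed_Collect_le continuous_intros)
      moreover have "W = M \<inter> {p. s \<le> - snd p \<and> u * - snd p \<le> fst p \<and> fst p \<le> v * - snd p}"
      proof -
        have "p \<in> W" if "p \<in> M" and h: "s \<le> - snd p" "u * - snd p \<le> fst p" "fst p \<le> v * - snd p" for p
        proof -
          obtain c' t' where p: "c' \<in> K" "p = ray c' t'" using point_cases[OF \<open>p \<in> M\<close>] by metis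
          then have t': "s \<le> t'" "0 < t'" and c': "u * t' \<le> t' * c'" "t' * c' \<le> v * t'" using h st by (auto simp: ray_def)
          then have "u \<le> c'" "c' \<le> v" by (simp_all add: mult.commute)
          then have c'': "u < c'" "c' < v" using p(1) u v by (metis order_le_less)+
          then have "ray c' s \<notin> M" using e(2)[of c'] u v by auto
          then have "s < t'" using t' p(2) \<open>p \<in> M\<close> by (metis order_le_less)
          then show ?thesis using \<open>p \<in> M\<close> p(2) c'' t' by (simp add: W_def ray_def mult.commute)
        qed
        then show ?thesis by (auto simp: W_def)
      qed
      ultimately show ?thesis by (simp add: closedin_closed_Int)
    qed
    ultimately have "W = {} \<or> W = M" using M(3) connected_clopen by blast
    moreover have "ray c t \<in> W" using assms(1) st u v by (simp add: W_def ray_def mult.commute)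
    moreover have "(0, 0) \<notin> W" using st by (simp add: W_def)
    ultimately show False using apex_mem by blast
  qed
qed

definition leg_length :: "real \<Rightarrow> real" where
  "leg_length c = Sup {t. ray c t \<in> M}"

lemma ray_mem_iff: "0 \<le> t \<Longrightarrow> ray c t \<in> M \<longleftrightarrow> t \<le> leg_length c"
  and leg_length_nonneg: "0 \<le> leg_length c"
proof -
  let ?S = "{t. ray c t \<in> M}"
  have "0 \<in> ?S" using apex_mem by (simp add: ray_def)
  have bdd: "bdd_above ?S" using ray_mem by (intro bdd_aboveI[of _ 1]) auto
  have "continuous_on UNIV (\<lambda>t. ray c t)" unfolding ray_def by (intro continuous_intros)
  then have "closed ((\<lambda>t. ray c t) -` M)" using closed_vimage compact_imp_closed[OF M(2)] by blast
  then have "closed ?S" by (simp add: vimage_def)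
  then have "leg_length c \<in> ?S" unfolding leg_length_def
    using \<open>0 \<in> ?S\<close> bdd by (intro closed_contains_Sup) auto
  moreover have up: "t \<le> leg_length c" if "t \<in> ?S" for t
    unfolding leg_length_def by (rule cSup_upper[OF that bdd])
  ultimately show "ray c t \<in> M \<longleftrightarrow> t \<le> leg_length c" if "0 \<le> t"
    using leg_downward_closed[of c "leg_length c" t] up[of t] that by auto
  show "0 \<le> leg_length c" using up[OF \<open>0 \<in> ?S\<close>] .
qed

text \<open>The closure discards the open set of directions near which no leg has positive length; there the
  supremum of the leg lengths would vanish.\<close>

definition legs :: "real set" where
  "legs = closure {c \<in> K. 0 < leg_length c}"

text \<open>A half line bounded by a point outside \<open>K\<close> meets \<open>K\<close> in a clopen set.\<close>

definition cuts :: "nat \<Rightarrow> real set" where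
  "cuts j = (if of_rat (from_nat j) \<in> K then {} else {..<of_rat (from_nat j)})"

lemma legs_subset: "legs \<subseteq> K"
  unfolding legs_def by (rule closure_minimal[OF _ compact_imp_closed[OF K(2)]]) blast

lemma long_leg_mem: "0 < leg_length c \<Longrightarrow> c \<in> legs"
proof -
  assume pos: "0 < leg_length c"
  then have "ray c (leg_length c) \<in> M" using ray_mem_iff by simp
  then have "c \<in> {c \<in> K. 0 < leg_length c}" using ray_mem pos by auto
  then show ?thesis unfolding legs_def by (rule subsetD[OF closure_subset])
qed

lemma cuts_separate:
  assumes "x \<in> K" "y \<in> K" "x < y" shows "\<exists>j. x \<in> cuts j \<and> y \<notin> cuts j"
proof -
  obtain z where z: "x < z" "z < y" "z \<notin> K" using cantor_set_gap[OF K(1) assms(3)] by metis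
  obtain e where e: "0 < e" "\<And>w. \<bar>w - z\<bar> < e \<Longrightarrow> w \<notin> K"
    using compact_imp_closed[OF K(2)] z(3) unfolding closed_def open_dist dist_real_def by force
  obtain q :: rat where q: "z < of_rat q" "of_rat q < min y (z + e)"
    using of_rat_dense[of z "min y (z + e)"] z e(1) by auto
  then have "of_rat q \<notin> K" using e(2)[of "of_rat q"] by auto
  then show ?thesis using q z by (intro exI[of _ "to_nat q"]) (simp add: cuts_def)
qed

text \<open>The only point of a leg that can be an end-point away from the apex is its tip, so density of
  the end-points becomes density of the tips.\<close>

lemma lelek_function_leg_length: "lelek_function legs leg_length cuts"
proof
  have "closed legs" by (simp add: legs_def)
  show "compact (fan_body legs leg_length)"
  proof -
    have "compact legs"
      using compact_Int_closed[OF K(2) \<open>closed legs\<close>] legs_subset by (simp add: Int_absorb1)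
    moreover have "closed ((\<lambda>p. ray (fst p) (snd p)) -` M)"
      by (rule closed_vimage[OF compact_imp_closed[OF M(2)] continuous_ray])
    moreover have "fan_body legs leg_length = (legs \<times> {0..1}) \<inter> (\<lambda>p. ray (fst p) (snd p)) -` M"
      using ray_mem_iff ray_mem by (fastforce simp: fan_body_def)
    ultimately show ?thesis by (simp add: compact_Int_closed compact_Times)
  qed
  show "legs \<noteq> {}"
  proof -
    obtain p where p: "p \<in> M" "p \<noteq> (0, 0)" using nontrivial by metis
    then obtain c t where ct: "0 \<le> t" "p = ray c t" using point_cases by metis
    then have "0 < t" using p(2) by (cases "t = 0") (auto simp: ray_def)
    then have "0 < leg_length c" using ct p ray_mem_iff[of t c] by simp
    then show ?thesis using long_leg_mem by blast
  qed
  show "0 \<le> leg_length c" for c by (rule leg_length_nonneg)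
  show "clopen_in legs (legs \<inter> cuts j)" for j
  proof (cases "of_rat (from_nat j) \<in> K")
    case True then show ?thesis by (simp add: cuts_def clopen_in_def)
  next
    case False
    then have "legs \<inter> cuts j = legs \<inter> {..of_rat (from_nat j)}"
      using legs_subset by (auto simp: cuts_def order_le_less)
    moreover have "legs \<inter> cuts j = legs \<inter> {..<of_rat (from_nat j)}" using False by (simp add: cuts_def)
    ultimately show ?thesis unfolding clopen_in_def
      by (metis closed_atMost closedin_closed_Int open_lessThan openin_open_Int)
  qed
  show "\<exists>j. (x \<in> cuts j) \<noteq> (y \<in> cuts j)" if "x \<in> legs" "y \<in> legs" "x \<noteq> y" for x y
    using that legs_subset cuts_separate[of x y] cuts_separate[of y x]
    by (metis linorder_neqE_linordered_idom subsetD)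
  show "\<exists>c\<in>U. 0 < leg_length c" if U: "clopen_in legs U" "U \<noteq> {}" for U
  proof -
    obtain T where T: "open T" "U = legs \<inter> T" using U(1) unfolding clopen_in_def openin_open by blast
    then have "T \<inter> closure {c \<in> K. 0 < leg_length c} \<noteq> {}" using U(2) by (auto simp: legs_def)
    then obtain d where "d \<in> T" "0 < leg_length d" using open_Int_closure_eq_empty[OF T(1)] by blast
    then show ?thesis using T(2) long_leg_mem by blast
  qed
  show "\<exists>c'\<in>U. a < leg_length c' \<and> leg_length c' < b"
    if U: "clopen_in legs U" "c \<in> U" and ab: "0 \<le> a" "a < b" "b \<le> leg_length c" for U c a b
  proof -
    obtain T where T: "open T" "U = legs \<inter> T" using U(1) unfolding clopen_in_def openin_open by blast
    define t where "t = (a + b) / 2"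
    have t: "0 < t" "a < t" "t < b" using ab by (auto simp: t_def)
    define N where "N = {p :: real \<times> real. a < - snd p \<and> - snd p < b}"
    define W where "W = N \<inter> (\<lambda>p. fst p / - snd p) -` T"
    have "open N" unfolding N_def by (intro open_Collect_conj open_Collect_less continuous_intros)
    moreover have "continuous_on N (\<lambda>p. fst p / - snd p)"
      using ab by (intro continuous_intros) (auto simp: N_def)
    ultimately have "open W" unfolding W_def using T(1) by (intro continuous_open_preimage)
    have "ray c t \<in> M" using t ab ray_mem_iff by simp
    moreover have "ray c t \<in> W" using t T(2) U(2) by (simp add: W_def N_def ray_def)
    ultimately obtain e where e: "e \<in> fan_endpoints (k ` M)" "g e \<in> W"
      using dense_subset_meets[OF dense g_cont \<open>open W\<close>, of "k (ray c t)"] gk by auto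
    then obtain r where r: "r \<in> M" "e = k r" by (auto simp: fan_endpoints_def)
    obtain c' t' where ct: "r = ray c' t'" using point_cases[OF r(1)] by metis
    have "ray c' t' \<in> W" using e(2) r gk ct by metis
    then have t': "a < t'" "t' < b" and c': "c' \<in> T" using ab by (auto simp: W_def N_def ray_def)
    have le: "t' \<le> leg_length c'" using r ct ray_mem_iff[of t' c'] t' ab by simp
    moreover have "\<not> t' < leg_length c'"
    proof
      assume "t' < leg_length c'"
      moreover have "ray c' u \<in> M" if "0 \<le> u" "u \<le> leg_length c'" for u using that ray_mem_iff by blast
      ultimately have "k (ray c' t') \<notin> fan_endpoints (k ` M)"
        using interior_of_leg_not_endpoint[OF k_cont k_inj, of 0 "leg_length c'" c' t'] t' ab by simp
      then show False using e r ct by blast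
    qed
    ultimately have "t' = leg_length c'" by simp
    moreover have "c' \<in> legs" using long_leg_mem le t' ab by simp
    ultimately show ?thesis using T(2) c' t' by blast
  qed
qed

lemma fan_chart_legs: "fan_chart legs leg_length (\<lambda>p. k (ray (fst p) (snd p))) (k ` M)"
proof -
  let ?E = "fan_body legs leg_length" and ?r = "\<lambda>p. ray (fst p) (snd p)"
  have img: "?r ` ?E = M"
  proof
    show "?r ` ?E \<subseteq> M" using ray_mem_iff by (auto simp: fan_body_def)
    show "M \<subseteq> ?r ` ?E"
    proof
      fix p assume "p \<in> M"
      then obtain c t where p: "0 \<le> t" "p = ray c t" using point_cases by metis
      then have le: "t \<le> leg_length c" using \<open>p \<in> M\<close> ray_mem_iff by simp
      show "p \<in> ?r ` ?E"
      proof (cases "t = 0")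
        case True
        obtain c0 where "c0 \<in> legs"
          using lelek_function.nonempty[OF lelek_function_leg_length] by blast
        then have "(c0, 0) \<in> ?E" using leg_length_nonneg by simp
        moreover have "p = ?r (c0, 0)" using p True by (simp add: ray_def)
        ultimately show ?thesis by (rule rev_image_eqI)
      next
        case False
        then have "(c, t) \<in> ?E" using p le long_leg_mem by simp
        moreover have "p = ?r (c, t)" using p by simp
        ultimately show ?thesis by (rule rev_image_eqI)
      qed
    qed
  qed
  show ?thesis unfolding fan_chart_def
  proof (intro conjI ballI)
    show "continuous_on ?E (\<lambda>p. k (?r p))"
      by (rule continuous_on_compose2[OF k_cont continuous_ray]) (simp add: img)
    show "(\<lambda>p. k (?r p)) ` ?E = k ` M" using img by (metis image_image)
    fix p q assume "p \<in> ?E" "q \<in> ?E"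
    then have "?r p \<in> M" "?r q \<in> M" using img by auto
    then have "k (?r p) = k (?r q) \<longleftrightarrow> ?r p = ?r q" by (rule inj_on_eq_iff[OF k_inj])
    then have "k (?r p) = k (?r q) \<longleftrightarrow> snd p = snd q \<and> (snd p = 0 \<or> fst p = fst q)"
      by (simp only: ray_eq_iff)
    then show "k (?r p) = k (?r q) \<longleftrightarrow> p = q \<or> snd p = 0 \<and> snd q = 0"
      by (auto simp: prod_eq_iff)
  qed
qed

end

theorem lelek_fan_chart:
  fixes L :: "'a::metric_space set"
  assumes "lelek_fan L"
  obtains C :: "real set" and \<phi> B \<pi> where "lelek_function C \<phi> B" "fan_chart C \<phi> \<pi> L"
proof -
  obtain Cf where Cf: "cantor_fan Cf" "L \<subseteq> Cf" and L: "continuum L" "\<exists>x\<in>L. \<exists>y\<in>L. x \<noteq> y"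
    "closure (fan_endpoints L) = L" using assms unfolding lelek_fan_def by blast
  obtain K where K: "K \<subseteq> {0..1}" "cantor_set K" "Cf homeomorphic planar_fan K"
    using Cf(1) unfolding cantor_fan_def by blast
  obtain g k where gk: "homeomorphism Cf (planar_fan K) g k" using K(3) homeomorphic_def by blast
  have "compact (planar_fan K)"
    using Cf(1) K(3) homeomorphic_compactness unfolding cantor_fan_def continuum_def by blast
  have "compact K"
  proof -
    have "continuous_on UNIV (\<lambda>c::real. (c, - 1 :: real))" by (intro continuous_intros)
    then have "closed ((\<lambda>c. (c, - 1)) -` planar_fan K)"
      using closed_vimage[OF compact_imp_closed[OF \<open>compact (planar_fan K)\<close>]] by blast
    moreover have "K = {0..1} \<inter> (\<lambda>c. (c, - 1)) -` planar_fan K"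
      using K(1) by (auto simp: planar_fan_eq ray_def)
    ultimately show ?thesis by (metis compact_Icc compact_Int_closed)
  qed
  have hom: "homeomorphism L (g ` L) g k"
    using homeomorphism_of_subsets[OF gk Cf(2)] Cf(2) gk by (metis homeomorphism_image1 image_mono order_refl)
  let ?M = "g ` L"
  have kM: "k ` ?M = L" using hom by (simp add: homeomorphism_def)
  have M: "?M \<subseteq> planar_fan K" "compact ?M" "connected ?M"
    using gk Cf(2) hom L(1) compact_continuous_image connected_continuous_image
    unfolding continuum_def by (metis homeomorphism_image1 image_mono, metis homeomorphism_cont1, metis homeomorphism_cont1)
  have hom': "homeomorphism ?M (k ` ?M) k g" using hom kM by (metis homeomorphism_sym)
  have ne: "\<exists>p\<in>?M. \<exists>q\<in>?M. p \<noteq> q" using L(2) hom by (metis homeomorphism_apply1 imageI)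
  have dense: "closure (fan_endpoints (k ` ?M)) = k ` ?M" using L(3) kM by simp
  note ctx = K(2) \<open>compact K\<close> M hom' ne dense
  show thesis
    using that[OF lelek_function_leg_length[OF ctx]] fan_chart_legs[OF ctx] kM by metis
qed

section \<open>A Lelek function on a space of itineraries\<close>

lemma sqrt2_combination_zero:
  fixes p q :: int
  assumes "of_int q * sqrt 2 = (of_int p :: real)"
  shows "q = 0" "p = 0"
proof -
  have irr: "sqrt 2 \<notin> \<rat>"
  proof
    assume "sqrt 2 \<in> \<rat>"
    then obtain m n :: nat where n: "n \<noteq> 0" and eq: "\<bar>sqrt 2\<bar> = real m / real n" and co: "coprime m n"
      by (rule Rats_abs_nat_div_natE)
    have "real m = sqrt 2 * real n" using eq n by (simp add: field_simps)
    then have "(real m)\<^sup>2 = (sqrt 2 * real n)\<^sup>2" by (rule arg_cong)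
    also have "\<dots> = 2 * (real n)\<^sup>2" by (simp add: power_mult_distrib)
    finally have "real (m\<^sup>2) = real (2 * n\<^sup>2)" by simp
    then have "m\<^sup>2 = 2 * n\<^sup>2" by (simp only: of_nat_eq_iff)
    moreover from this have "even m" by (metis dvd_triv_left even_power)
    then obtain k where "m = 2 * k" ..
    ultimately have "n\<^sup>2 = 2 * k\<^sup>2" by (simp add: power2_eq_square)
    then have "even n" by (metis dvd_triv_left even_power)
    with \<open>even m\<close> co show False by (auto dest: coprime_common_divisor)
  qed
  show "q = 0"
  proof (rule ccontr)
    assume "q \<noteq> 0"
    then have "sqrt 2 = of_int p / of_int q" using assms by (simp add: field_simps)
    then show False using irr by (metis Rats_divide Rats_of_int)
  qed
  then show "p = 0" using assms by simp
qed

text \<open>Dirichlet's theorem provides a combination \<open>d\<close> with \<open>0 < \<bar>d\<bar> < \<epsilon>\<close>.  Multiples of \<open>d\<close> move towards \<open>x\<close> in small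
  steps, from a start far enough on the other side of \<open>x\<close> so that only non-negative coefficients
  occur.\<close>

lemma sqrt2_combinations_dense:
  fixes x \<epsilon> :: real
  assumes "0 < \<epsilon>"
  obtains p q :: nat where "x - \<epsilon> < real q * sqrt 2 - real p" "real q * sqrt 2 - real p \<le> x"
proof -
  obtain K :: nat where K: "0 < K" "1 / real K < \<epsilon>"
    using assms by (metis inverse_eq_divide real_arch_inverse gr_zeroI)
  obtain h k where hk: "0 < k" "\<bar>of_int k * sqrt 2 - of_int h\<bar> < 1 / real K"
    using Dirichlet_approx[OF \<open>0 < K\<close>] by metis
  define d where "d = of_int k * sqrt 2 - of_int h"
  have d: "\<bar>d\<bar> < \<epsilon>" "d \<noteq> 0" using hk K sqrt2_combination_zero[of k h] by (auto simp: d_def)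
  have h: "0 \<le> h"
  proof -
    have "1 \<le> of_int k * sqrt 2"
      using mult_mono[of 1 "of_int k :: real" 1 "sqrt 2"] hk by simp
    moreover have "1 / real K \<le> 1" using K by simp
    ultimately have "(-1::real) < of_int h" using hk by linarith
    then show ?thesis by linarith
  qed
  have dnat: "d = real (nat k) * sqrt 2 - real (nat h)" using h hk by (simp add: d_def)
  show thesis
  proof (cases "0 < d")
    case True
    define p0 where "p0 = nat \<lceil>- x\<rceil>"
    have p0: "0 \<le> x + real p0" unfolding p0_def by linarith
    define m where "m = nat \<lfloor>(x + real p0) / d\<rfloor>"
    have "0 \<le> (x + real p0) / d" using p0 True by simp
    then have "real m \<le> (x + real p0) / d" "(x + real p0) / d < real m + 1"
      unfolding m_def by linarith+
    then have m: "real m * d \<le> x + real p0" "x + real p0 < real m * d + d"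
      using True by (simp_all add: field_simps)
    have "real (m * nat k) * sqrt 2 - real (m * nat h + p0) = real m * d - real p0"
      unfolding dnat by (simp add: algebra_simps)
    then show thesis using m d by (intro that[of "m * nat k" "m * nat h + p0"]) linarith+
  next
    case False
    define q0 where "q0 = nat \<lceil>x\<rceil>"
    have "x \<le> real q0" unfolding q0_def by linarith
    also have "\<dots> \<le> real q0 * sqrt 2" using mult_left_mono[of 1 "sqrt 2" "real q0"] by simp
    finally have q0: "x \<le> real q0 * sqrt 2" .
    define m where "m = nat \<lceil>(real q0 * sqrt 2 - x) / (-d)\<rceil>"
    have "0 \<le> (real q0 * sqrt 2 - x) / (-d)" using q0 False by (intro divide_nonneg_nonneg) simp_all
    then have "(real q0 * sqrt 2 - x) / (-d) \<le> real m" "real m < (real q0 * sqrt 2 - x) / (-d) + 1"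
      unfolding m_def by linarith+
    then have m: "real q0 * sqrt 2 - x \<le> real m * (-d)" "real m * (-d) < real q0 * sqrt 2 - x + (-d)"
      using False d by (simp_all add: field_simps)
    have "real (m * nat k + q0) * sqrt 2 - real (m * nat h) = real m * d + real q0 * sqrt 2"
      unfolding dnat by (simp add: algebra_simps)
    then show thesis using m d by (intro that[of "m * nat k + q0" "m * nat h"]) linarith+
  qed
qed

lemma open_coordinate_vimage: "open U \<Longrightarrow> open ((\<lambda>z :: 'a \<Rightarrow> 'b::topological_space. z i) -` U)"
  by (rule open_vimage[OF _ continuous_on_product_coordinates])

text \<open>Product spaces inherit the separation axioms; this makes the space of itineraries Hausdorff.  The two weaker ones come first because class
  arities must grow from the superclasses downwards.\<close>

instance "fun" :: (type, t0_space) t0_space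
proof
  fix x y :: "'a \<Rightarrow> 'b" assume "x \<noteq> y"
  then obtain i where i: "x i \<noteq> y i" by blast
  obtain U where "open U" "(x i \<in> U) \<noteq> (y i \<in> U)" using t0_space_class.t0_space[OF i] by blast
  then show "\<exists>U. open U \<and> (x \<in> U) \<noteq> (y \<in> U)"
    by (intro exI[of _ "(\<lambda>z. z i) -` U"] conjI open_coordinate_vimage) simp_all
qed

instance "fun" :: (type, t1_space) t1_space
proof
  fix x y :: "'a \<Rightarrow> 'b" assume "x \<noteq> y"
  then obtain i where i: "x i \<noteq> y i" by blast
  obtain U where "open U" "x i \<in> U" "y i \<notin> U" using t1_space_class.t1_space[OF i] by blast
  then show "\<exists>U. open U \<and> x \<in> U \<and> y \<notin> U"
    by (intro exI[of _ "(\<lambda>z. z i) -` U"] conjI open_coordinate_vimage) simp_all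
qed

instance "fun" :: (type, t2_space) t2_space
proof
  fix x y :: "'a \<Rightarrow> 'b" assume "x \<noteq> y"
  then obtain i where i: "x i \<noteq> y i" by blast
  obtain U V where "open U" "open V" "x i \<in> U" "y i \<in> V" "U \<inter> V = {}"
    using hausdorff[OF i] by blast
  then show "\<exists>U V. open U \<and> open V \<and> x \<in> U \<and> y \<in> V \<and> U \<inter> V = {}"
    by (intro exI[of _ "(\<lambda>z. z i) -` U"] exI[of _ "(\<lambda>z. z i) -` V"] conjI open_coordinate_vimage)
      (simp_all flip: vimage_Int)
qed

text \<open>The letters of an itinerary drive the logarithm of the height of a point: \<open>True\<close> raises it by
  \<open>sqrt 2\<close> and \<open>False\<close> lowers it by 1.\<close>

definition rise :: "bool \<Rightarrow> real" where
  "rise b = (if b then sqrt 2 else - 1)"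

text \<open>The total change of the logarithmic height from time 0 to time \<open>i\<close>, with the sign convention of an
  oriented sum for negative times.\<close>

definition climb :: "(int \<Rightarrow> bool) \<Rightarrow> int \<Rightarrow> real" where
  "climb s i = (\<Sum>j\<in>{0..<i}. rise (s j)) - (\<Sum>j\<in>{i..<0}. rise (s j))"

lemma climb_0 [simp]: "climb s 0 = 0"
  by (simp add: climb_def)

lemma climb_step: "climb s (i + 1) = climb s i + rise (s i)"
proof (cases "0 \<le> i")
  case True
  then have "{0..<i + 1} = insert i {0..<i}" by auto
  then show ?thesis using True by (simp add: climb_def)
next
  case False
  then have "{i..<0} = insert i {i + 1..<0}" by auto
  then show ?thesis using False by (simp add: climb_def)
qed

lemma climb_diff_cong:
  assumes "x \<le> y" "\<And>j. x \<le> j \<Longrightarrow> j < y \<Longrightarrow> a (j + k) = b j"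
  shows "climb a (y + k) - climb a (x + k) = climb b y - climb b x"
  using assms
proof (induction y rule: int_ge_induct)
  case (step i)
  have "climb a (i + 1 + k) = climb a (i + k) + rise (a (i + k))"
    using climb_step[of a "i + k"] by (simp add: algebra_simps)
  then show ?case using step climb_step[of b i] by simp
qed simp

lemma climb_const: "climb (\<lambda>_. b) i = of_int i * rise b"
proof (induction i rule: int_induct[of _ 0])
  case (step1 i) then show ?case using climb_step[of "\<lambda>_. b" i] by (simp add: algebra_simps)
next
  case (step2 i) then show ?case using climb_step[of "\<lambda>_. b" "i - 1"] by (simp add: algebra_simps)
qed simp

lemma climb_run:
  assumes "x \<le> y" "\<And>j. x \<le> j \<Longrightarrow> j < y \<Longrightarrow> a j = b"
  shows "climb a y = climb a x + of_int (y - x) * rise b"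
  using climb_diff_cong[of x y a 0 "\<lambda>_. b"] assms by (simp add: climb_const algebra_simps)

lemma climb_cong_le:
  assumes "0 \<le> N" "\<And>j. j < N \<Longrightarrow> a j = b j" "i \<le> N"
  shows "climb a i = climb b i"
proof (cases "0 \<le> i")
  case True then show ?thesis using climb_diff_cong[of 0 i a 0 b] assms by simp
next
  case False then show ?thesis using climb_diff_cong[of i 0 a 0 b] assms by simp
qed

lemma climb_shift: "climb (\<lambda>i. s (i + k)) i = climb s (i + k) - climb s k"
proof (cases "0 \<le> i")
  case True then show ?thesis using climb_diff_cong[of 0 i s k "\<lambda>i. s (i + k)"] by simp
next
  case False then show ?thesis using climb_diff_cong[of i 0 s k "\<lambda>i. s (i + k)"] by simp
qed

lemma abs_rise_le: "\<bar>rise b\<bar> \<le> 2"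
  using sqrt2_less_2 by (auto simp: rise_def)

lemma abs_climb_le: "\<bar>climb s i\<bar> \<le> 2 * of_int \<bar>i\<bar>"
proof (induction i rule: int_induct[of _ 0])
  case (step1 i) then show ?case using climb_step[of s i] abs_rise_le[of "s i"] by simp
next
  case (step2 i) then show ?case using climb_step[of s "i - 1"] abs_rise_le[of "s (i - 1)"] by simp
qed simp

lemma continuous_climb: "continuous_on UNIV (\<lambda>s. climb s i)"
proof -
  have "continuous_on UNIV (\<lambda>s :: int \<Rightarrow> bool. rise (s j))" for j
    by (rule continuous_on_compose2[OF Topological_Spaces.continuous_on_discrete[of UNIV rise]
          continuous_on_product_coordinates]) simp
  then show ?thesis unfolding climb_def by (intro continuous_on_diff continuous_on_sum)
qed

text \<open>The largest height at time 0 from which the height stays at most 1 at all times, past and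
  future.\<close>

definition headroom :: "(int \<Rightarrow> bool) \<Rightarrow> real" where
  "headroom s = (INF i. exp (- climb s i))"

lemma le_headroom_iff: "t \<le> headroom s \<longleftrightarrow> (\<forall>i. t * exp (climb s i) \<le> 1)"
proof -
  have "bdd_below (range (\<lambda>i. exp (- climb s i)))" by (intro bdd_belowI[of _ 0]) auto
  then have "t \<le> headroom s \<longleftrightarrow> (\<forall>i. t \<le> exp (- climb s i))"
    unfolding headroom_def by (subst le_cINF_iff) auto
  also have "\<dots> \<longleftrightarrow> (\<forall>i. t * exp (climb s i) \<le> 1)"
    by (simp add: exp_minus field_simps)
  finally show ?thesis .
qed

lemma headroom_nonneg: "0 \<le> headroom s"
  by (simp add: le_headroom_iff)

lemma headroom_le: "headroom s * exp (climb s i) \<le> 1"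
  using le_headroom_iff[of "headroom s" s] by simp

text \<open>With \<open>J = {}\<close> these are all itineraries.  With \<open>J = {..<0}\<close> the past is frozen to a climb that has gone
  on forever, which puts no bound on the height at time 0, so that only the future matters.\<close>

definition itineraries :: "int set \<Rightarrow> (int \<Rightarrow> bool) set" where
  "itineraries J = {s. \<forall>i\<in>J. s i}"

abbreviation model_fan :: "((int \<Rightarrow> bool) \<times> real) set" where
  "model_fan \<equiv> fan_body UNIV headroom"

lemma in_model_fan: "(s, t) \<in> model_fan \<longleftrightarrow> 0 \<le> t \<and> (\<forall>i. t * exp (climb s i) \<le> 1)"
  by (simp add: le_headroom_iff)

lemma in_model_fan_log: "0 < t \<Longrightarrow> (s, t) \<in> model_fan \<longleftrightarrow> (\<forall>i. ln t + climb s i \<le> 0)"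
proof -
  assume t: "0 < t"
  have "t * exp (climb s i) \<le> 1 \<longleftrightarrow> ln t + climb s i \<le> 0" for i
    using t ln_le_zero_iff[of "t * exp (climb s i)"] by (simp add: ln_mult)
  then show ?thesis using t by (simp add: in_model_fan del: in_fan_body)
qed

lemma compact_sequences: "compact (UNIV :: (int \<Rightarrow> bool) set)"
proof -
  have "compact_space (euclidean :: bool topology)"
    by (simp add: compact_space_def finite_imp_compact)
  then have "compact_space (product_topology (\<lambda>i::int. euclidean :: bool topology) UNIV)"
    by (simp add: compact_space_product_topology)
  then show ?thesis by (simp add: euclidean_product_topology compact_space_def)
qed

lemma continuous_coordinate: "continuous_on UNIV (\<lambda>s :: int \<Rightarrow> bool. s i)"
  by simp

lemma clopen_coordinate: "open {s :: int \<Rightarrow> bool. s i}" "closed {s :: int \<Rightarrow> bool. s i}"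
proof -
  have "{s :: int \<Rightarrow> bool. s i} = (\<lambda>s. s i) -` {True}" by auto
  then show "open {s :: int \<Rightarrow> bool. s i}" "closed {s :: int \<Rightarrow> bool. s i}"
    using open_vimage[OF open_discrete continuous_coordinate] closed_vimage[OF _ continuous_coordinate]
    by (metis, metis closed_def open_discrete)
qed

lemma compact_model_body: "compact (fan_body (itineraries J) headroom)"
proof -
  have "fan_body (itineraries J) headroom =
    (UNIV \<times> {0..1}) \<inter> ((\<Inter>i\<in>J. {s. s i}) \<times> UNIV) \<inter> {p. \<forall>i. snd p * exp (climb (fst p) i) \<le> 1}"
    (is "_ = ?A \<inter> ?B \<inter> ?C")
  proof -
    have "t \<le> 1" if "t \<le> headroom s" for s t
      using that[unfolded le_headroom_iff, rule_format, of 0] by simp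
    then show ?thesis by (auto simp: fan_body_def itineraries_def le_headroom_iff)
  qed
  moreover have "compact ?A" by (intro compact_Times compact_sequences compact_Icc)
  moreover have "closed ?B" by (intro closed_Times closed_INT ballI clopen_coordinate closed_UNIV)
  moreover have "closed ?C"
    by (intro closed_Collect_all closed_Collect_le continuous_on_mult continuous_on_snd
        continuous_on_id continuous_on_const continuous_on_exp
        continuous_on_compose2[OF continuous_climb continuous_on_fst[OF continuous_on_id]]) auto
  ultimately show ?thesis by (simp add: compact_Int_closed)
qed

lemma compact_model_fan: "compact model_fan"
  using compact_model_body[of "{}"] by (simp add: itineraries_def)

lemma open_contains_cylinder:
  assumes "open U" "s \<in> U"
  obtains N :: int where "1 \<le> N" "\<And>c. (\<And>i. - N \<le> i \<Longrightarrow> i < N \<Longrightarrow> c i = s i) \<Longrightarrow> c \<in> (U :: (int \<Rightarrow> bool) set)"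
proof -
  have "openin (product_topology (\<lambda>i. euclidean) UNIV) U" using assms open_fun_def by metis
  from product_topology_open_contains_basis[OF this \<open>s \<in> U\<close>]
  obtain X where X: "s \<in> (\<Pi>\<^sub>E i\<in>UNIV. X i)" "finite {i. X i \<noteq> UNIV}" "(\<Pi>\<^sub>E i\<in>UNIV. X i) \<subseteq> U"
    by auto
  define N where "N = Max (insert 0 (abs ` {i. X i \<noteq> UNIV})) + 1"
  have fin: "finite (insert 0 (abs ` {i. X i \<noteq> UNIV}))" using X(2) by simp
  have N: "\<bar>i\<bar> < N" if "X i \<noteq> UNIV" for i
    using Max_ge[OF fin, of "\<bar>i\<bar>"] that by (simp add: N_def)
  show thesis
  proof
    show "1 \<le> N" using Max_ge[OF fin, of 0] by (simp add: N_def)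
    fix c assume c: "\<And>i. - N \<le> i \<Longrightarrow> i < N \<Longrightarrow> c i = s i"
    have "c i \<in> X i" for i
    proof (cases "X i = UNIV")
      case False
      then have "c i = s i" using N[OF False] by (intro c) auto
      then show ?thesis using X(1) by auto
    qed simp
    then show "c \<in> U" using X(3) by auto
  qed
qed

text \<open>The connecting tool for everything that follows: \<open>c\<close> follows \<open>s\<close> up to time \<open>N\<close>, then descends for \<open>p\<close>
  steps, climbs for \<open>q\<close> steps, and from then on copies \<open>s'\<close> from its time \<open>- N\<close> onwards, so that time \<open>n\<close> of \<open>c\<close>
  corresponds to time 0 of \<open>s'\<close>.  Density of the combinations \<open>q * sqrt 2 - p\<close> allows to arrive
  just below the height that the second orbit has at that time.  Approaching it from below keeps
  all later heights under those of the second orbit, hence at most 1; on the connecting piece the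
  height is at most that of one of its ends.\<close>

lemma splice:
  assumes s: "(s, t) \<in> model_fan" "0 < t" and s': "(s', t') \<in> model_fan" "0 < t'"
    and N: "0 \<le> N" and "0 < \<epsilon>"
  shows "\<exists>c n. (\<forall>i<N. c i = s i) \<and> (\<forall>i\<ge>- N. c (i + int n) = s' i) \<and>
    2 * N \<le> int n \<and> (c, t) \<in> model_fan \<and>
    t' * exp (- \<epsilon>) < t * exp (climb c (int n)) \<and> t * exp (climb c (int n)) \<le> t'"
proof -
  define x where "x = (ln t' + climb s' (- N)) - (ln t + climb s N)"
  obtain p q :: nat where pq: "x - \<epsilon> < real q * sqrt 2 - real p" "real q * sqrt 2 - real p \<le> x"
    using sqrt2_combinations_dense[OF \<open>0 < \<epsilon>\<close>] by metis
  define n where "n = nat (2 * N) + p + q"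
  have n: "int n = 2 * N + int p + int q" using N by (simp add: n_def)
  define c where "c i = (if i < N then s i else if i < N + int p then False
    else if i < N + int p + int q then True else s' (i - int n))" for i
  have c1: "c i = s i" if "i < N" for i using that by (simp add: c_def)
  have c2: "c (i + int n) = s' i" if "- N \<le> i" for i using that n by (simp add: c_def)
  have sl: "ln t + climb s i \<le> 0" for i using s in_model_fan_log by blast
  have sl': "ln t' + climb s' i \<le> 0" for i using s' in_model_fan_log by blast
  have k1: "climb c i = climb s i" if "i \<le> N" for i
    using climb_cong_le[OF N _ that] c1 by blast
  have k2: "climb c i = climb s N - of_int (i - N)" if "N \<le> i" "i \<le> N + int p" for i
    using climb_run[of N i c False] that k1[of N] by (simp add: c_def rise_def)
  have k3: "climb c i = climb s N - real p + of_int (i - (N + int p)) * sqrt 2"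
    if "N + int p \<le> i" "i \<le> N + int p + int q" for i
    using climb_run[of "N + int p" i c True] that k2[of "N + int p"] by (simp add: c_def rise_def)
  define Z where "Z = ln t + climb c (N + int p + int q)"
  have Z: "Z = ln t + climb s N - real p + real q * sqrt 2"
    using k3[of "N + int p + int q"] by (simp add: Z_def)
  then have Z1: "Z \<le> ln t' + climb s' (- N)" "ln t' + climb s' (- N) - \<epsilon> < Z"
    using pq unfolding x_def by linarith+
  have k4: "ln t + climb c (i + int n) = Z + climb s' i - climb s' (- N)" if "- N \<le> i" for i
  proof -
    have "climb c (i + int n) - climb c (- N + int n) = climb s' i - climb s' (- N)"
      by (rule climb_diff_cong[OF that]) (simp add: c2)
    moreover have "climb c (- N + int n) = climb c (N + int p + int q)"
      using n by (intro arg_cong[of _ _ "climb c"]) simp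
    ultimately show ?thesis unfolding Z_def by simp
  qed
  have fin: "ln t + climb c i \<le> 0" for i
  proof -
    consider "i \<le> N" | "N \<le> i" "i \<le> N + int p" | "N + int p \<le> i" "i \<le> N + int p + int q"
      | "N + int p + int q \<le> i" by linarith
    then show ?thesis
    proof cases
      case 1 then show ?thesis using k1 sl by simp
    next
      case 2
      then have "0 \<le> (of_int (i - N) :: real)" by simp
      then show ?thesis using k2[OF 2] sl[of N] by linarith
    next
      case 3
      then have "of_int (i - (N + int p)) \<le> (real q)" by linarith
      then have "of_int (i - (N + int p)) * sqrt 2 \<le> real q * sqrt 2" by (intro mult_right_mono) auto
      then show ?thesis using k3[OF 3] Z Z1 sl'[of "- N"] by linarith
    next
      case 4
      then show ?thesis using k4[of "i - int n"] Z1 sl'[of "i - int n"] n by simp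
    qed
  qed
  have end': "ln t + climb c (int n) = Z - climb s' (- N)" using k4[of 0] N by simp
  have "t * exp (climb c (int n)) = exp (Z - climb s' (- N))"
    using s(2) by (simp add: end'[symmetric] exp_add)
  moreover have "exp (Z - climb s' (- N)) \<le> exp (ln t')" "exp (ln t' - \<epsilon>) < exp (Z - climb s' (- N))"
    unfolding exp_le_cancel_iff exp_less_cancel_iff using Z1 by linarith+
  moreover have "exp (ln t' - \<epsilon>) = t' * exp (- \<epsilon>)" using s'(2) by (simp add: exp_diff exp_minus field_simps)
  ultimately have "t' * exp (- \<epsilon>) < t * exp (climb c (int n))" "t * exp (climb c (int n)) \<le> t'"
    using s'(2) by simp_all
  moreover have "(c, t) \<in> model_fan" using fin in_model_fan_log s(2) by blast
  moreover have "2 * N \<le> int n" using n by simp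
  ultimately show ?thesis using c1 c2 by blast
qed

text \<open>The itinerary that climbs up to time 0 and descends afterwards has its highest point at time 0.
  Splicing it in produces orbits that come close to the maximal height 1.\<close>

lemma summit_in_model_fan: "((\<lambda>i. i < 0), 1) \<in> model_fan"
proof -
  have "climb (\<lambda>i. i < 0) i \<le> 0" for i
  proof (cases "0 \<le> i")
    case True
    then show ?thesis using climb_run[of 0 i "\<lambda>i. i < 0" False] by (simp add: rise_def)
  next
    case False
    then have "climb (\<lambda>i. i < 0) i = of_int i * sqrt 2"
      using climb_run[of i 0 "\<lambda>i. i < 0" True] by (simp add: rise_def)
    then show ?thesis using False by (simp add: mult_le_0_iff)
  qed
  then show ?thesis by (simp add: in_model_fan_log del: in_fan_body)
qed

text \<open>Outside the window \<open>{-N..<N}\<close> the height falls off in both directions, so the headroom is positive.\<close>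

definition tame :: "int \<Rightarrow> (int \<Rightarrow> bool) \<Rightarrow> int \<Rightarrow> bool" where
  "tame N s i = (if i < - N then True else if i < N then s i else False)"

lemma headroom_tame_pos:
  assumes "0 \<le> N"
  shows "0 < headroom (tame N s)"
proof -
  let ?c = "tame N s"
  have "climb ?c i \<le> 2 * of_int N" for i
  proof -
    have *: "climb ?c j \<le> 2 * of_int N" if "- N \<le> j" "j \<le> N" for j
      using abs_climb_le[of ?c j] that by linarith
    consider "i \<le> - N" | "- N \<le> i" "i \<le> N" | "N \<le> i" by linarith
    then show ?thesis
    proof cases
      case 1
      have "climb ?c (- N) = climb ?c i + of_int (- N - i) * sqrt 2"
        using climb_run[of i "- N" ?c True] 1 by (simp add: tame_def rise_def)
      moreover have "0 \<le> of_int (- N - i) * sqrt 2" using 1 by simp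
      ultimately show ?thesis using *[of "- N"] assms by linarith
    next
      case 3
      have "climb ?c i = climb ?c N - of_int (i - N)"
        using climb_run[of N i ?c False] 3 assms by (simp add: tame_def rise_def)
      moreover have "0 \<le> (of_int (i - N) :: real)" using 3 by simp
      ultimately show ?thesis using *[of N] assms by linarith
    qed (rule *)
  qed
  then have "exp (- (2 * of_int N)) * exp (climb ?c i) \<le> 1" for i
    by (simp flip: exp_add)
  then have "exp (- (2 * of_int N)) \<le> headroom ?c" by (simp add: le_headroom_iff)
  then show ?thesis by (meson exp_gt_zero less_le_trans)
qed

definition reads :: "nat \<Rightarrow> (int \<Rightarrow> bool) set" where
  "reads j = {s. s (from_nat j)}"

text \<open>Density of the tips: splice the summit into the given itinerary, starting from a height \<open>t\<close> between \<open>a\<close>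
  and \<open>b\<close>.  The new orbit stays below 1 but comes close to 1, so its headroom exceeds \<open>t\<close> only slightly.
  The letters at negative times are unchanged, which keeps the itinerary in \<open>itineraries J\<close>.\<close>

lemma lelek_function_headroom:
  assumes J: "J \<subseteq> {..<0}"
  shows "lelek_function (itineraries J) headroom reads"
proof
  let ?C = "itineraries J"
  show "?C \<noteq> {}" by (auto simp: itineraries_def intro!: exI[of _ "\<lambda>_. True"])
  show "compact (fan_body ?C headroom)" by (rule compact_model_body)
  show "0 \<le> headroom c" for c by (rule headroom_nonneg)
  show "clopen_in ?C (?C \<inter> reads j)" for j
    using clopen_coordinate[of "from_nat j"] unfolding clopen_in_def reads_def
    by (simp add: openin_open_Int closedin_closed_Int)
  show "\<exists>j. (x \<in> reads j) \<noteq> (y \<in> reads j)" if "x \<noteq> y" for x y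
  proof -
    from that obtain i where "x i \<noteq> y i" by blast
    then show ?thesis by (intro exI[of _ "to_nat i"]) (simp add: reads_def)
  qed
  have near: "\<exists>N\<ge>1. \<forall>c. (\<forall>i. - N \<le> i \<and> i < N \<longrightarrow> c i = s i) \<and> (\<forall>i<0. s i \<longrightarrow> c i) \<longrightarrow> c \<in> U"
    if "clopen_in ?C U" "s \<in> U" for U s
  proof -
    obtain T where T: "open T" "U = ?C \<inter> T"
      using \<open>clopen_in ?C U\<close> unfolding clopen_in_def openin_open by blast
    then have "s \<in> T" "s \<in> ?C" using that by auto
    then obtain N where N: "1 \<le> N" "\<And>c. (\<And>i. - N \<le> i \<Longrightarrow> i < N \<Longrightarrow> c i = s i) \<Longrightarrow> c \<in> T"
      using open_contains_cylinder[OF T(1), of s] by metis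
    show ?thesis
    proof (intro exI[of _ N] conjI allI impI)
      fix c assume c: "(\<forall>i. - N \<le> i \<and> i < N \<longrightarrow> c i = s i) \<and> (\<forall>i<0. s i \<longrightarrow> c i)"
      have "c \<in> T" by (rule N(2)) (use c in blast)
      moreover have "c \<in> ?C" using c J \<open>s \<in> ?C\<close> by (auto simp: itineraries_def)
      ultimately show "c \<in> U" using T by blast
    qed (rule N(1))
  qed
  show "\<exists>c\<in>U. 0 < headroom c" if U: "clopen_in ?C U" "U \<noteq> {}" for U
  proof -
    obtain s where "s \<in> U" using U by blast
    from near[OF U(1) this] obtain N where "1 \<le> N"
      and N: "\<And>c. (\<forall>i. - N \<le> i \<and> i < N \<longrightarrow> c i = s i) \<and> (\<forall>i<0. s i \<longrightarrow> c i) \<Longrightarrow> c \<in> U" by blast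
    have "tame N s \<in> U" by (rule N) (use \<open>1 \<le> N\<close> in \<open>auto simp: tame_def\<close>)
    then show ?thesis using headroom_tame_pos[of N s] \<open>1 \<le> N\<close> by (intro bexI[of _ "tame N s"]) auto
  qed
  show "\<exists>c'\<in>U. a < headroom c' \<and> headroom c' < b"
    if U: "clopen_in ?C U" "s \<in> U" and ab: "0 \<le> a" "a < b" "b \<le> headroom s" for U s a b
  proof -
    from near[OF U] obtain N where "1 \<le> N"
      and N: "\<And>c. (\<forall>i. - N \<le> i \<and> i < N \<longrightarrow> c i = s i) \<and> (\<forall>i<0. s i \<longrightarrow> c i) \<Longrightarrow> c \<in> U" by blast
    define t where "t = (a + b) / 2"
    have t: "0 < t" "a < t" "t < b" using ab by (auto simp: t_def)
    define \<epsilon> where "\<epsilon> = ln (b / t)"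
    have \<epsilon>: "0 < \<epsilon>" "exp (- \<epsilon>) = t / b" using t ab by (auto simp: \<epsilon>_def exp_minus)
    have "(s, t) \<in> model_fan" "0 \<le> N" using t ab \<open>1 \<le> N\<close> by simp_all
    from splice[OF this(1) t(1) summit_in_model_fan zero_less_one this(2) \<epsilon>(1)]
    obtain c n where c: "\<forall>i<N. c i = s i" "(c, t) \<in> model_fan"
      "1 * exp (- \<epsilon>) < t * exp (climb c (int n))" by blast
    have "c \<in> U" by (rule N) (use c(1) \<open>1 \<le> N\<close> in auto)
    moreover have "a < headroom c" using c(2) t by simp
    moreover have "headroom c < b"
    proof -
      have "t / b < t * exp (climb c (int n))" using c(3) \<epsilon> by simp
      then have "1 < b * exp (climb c (int n))" using t ab by (simp add: field_simps)
      then have "headroom c * exp (climb c (int n)) < b * exp (climb c (int n))"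
        using headroom_le[of c "int n"] by linarith
      then show ?thesis by simp
    qed
    ultimately show ?thesis by blast
  qed
qed


section \<open>Chaotic dynamics on the model fan\<close>

text \<open>The skew product over the shift: reading the letter at time 0 moves the point to time 1.\<close>

definition turn :: "(int \<Rightarrow> bool) \<times> real \<Rightarrow> (int \<Rightarrow> bool) \<times> real" where
  "turn p = ((\<lambda>i. fst p (i + 1)), snd p * exp (rise (fst p 0)))"

lemma turn_iterate:
  "(turn ^^ n) p = ((\<lambda>i. fst p (i + int n)), snd p * exp (climb (fst p) (int n)))"
proof (induction n)
  case (Suc n)
  have "climb (fst p) (1 + int n) = climb (fst p) (int n) + rise (fst p (int n))"
    using climb_step[of "fst p" "int n"] by (simp add: add.commute)
  then show ?case using Suc by (simp add: turn_def exp_add algebra_simps)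
qed simp

lemma turn_iterate_mem:
  assumes "p \<in> model_fan" shows "(turn ^^ n) p \<in> model_fan"
proof (cases p)
  case (Pair s t)
  have st: "0 \<le> t" "\<And>i. t * exp (climb s i) \<le> 1"
    using assms unfolding Pair in_model_fan by blast+
  have "exp (climb s (int n)) * exp (climb (\<lambda>i. s (i + int n)) i) = exp (climb s (i + int n))" for i
    by (simp add: climb_shift flip: exp_add)
  then have "t * exp (climb s (int n)) * exp (climb (\<lambda>i. s (i + int n)) i) \<le> 1" for i
    using st(2)[of "i + int n"] by (simp only: mult.assoc)
  then show ?thesis unfolding turn_iterate Pair in_model_fan fst_conv snd_conv using st(1) by simp
qed

lemma continuous_fst_coordinate: "continuous_on UNIV (\<lambda>p :: (int \<Rightarrow> bool) \<times> real. fst p j)"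
  by (rule continuous_on_compose2[OF continuous_coordinate continuous_on_fst[OF continuous_on_id]]) simp

lemma continuous_turn: "continuous_on UNIV turn"
proof -
  have "continuous_on UNIV (\<lambda>p :: (int \<Rightarrow> bool) \<times> real. rise (fst p 0))"
    by (rule continuous_on_compose2[OF Topological_Spaces.continuous_on_discrete[of UNIV rise]
          continuous_fst_coordinate]) simp
  then have "continuous_on UNIV (\<lambda>p :: (int \<Rightarrow> bool) \<times> real. snd p * exp (rise (fst p 0)))"
    by (intro continuous_on_mult continuous_on_exp continuous_on_snd continuous_on_id)
  moreover have "continuous_on UNIV (\<lambda>p :: (int \<Rightarrow> bool) \<times> real. \<lambda>i. fst p (i + 1))"
    by (rule continuous_on_coordinatewise_then_product) (rule continuous_fst_coordinate)
  ultimately show ?thesis unfolding turn_def[abs_def] by (intro continuous_on_Pair)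
qed

lemma open_contains_branch_point:
  assumes "open W" "p \<in> W" "p \<in> model_fan"
  obtains s t N e where "(s, t) \<in> model_fan" "0 < t" "(1::int) \<le> N" "0 < e"
    "\<And>c \<tau>. (\<And>i. - N \<le> i \<Longrightarrow> i < N \<Longrightarrow> c i = s i) \<Longrightarrow> \<bar>\<tau> - t\<bar> < e \<Longrightarrow> (c, \<tau>) \<in> W"
proof -
  obtain s t where p: "p = (s, t)" by (cases p)
  from open_prod_elim[OF assms(1,2)] obtain A T where "open A" "open T" "p \<in> A \<times> T" "A \<times> T \<subseteq> W"
    by blast
  then have AT: "open A" "open T" "s \<in> A" "t \<in> T" "A \<times> T \<subseteq> W" by (simp_all add: p)
  obtain N where N: "1 \<le> N" "\<And>c. (\<And>i. - N \<le> i \<Longrightarrow> i < N \<Longrightarrow> c i = s i) \<Longrightarrow> c \<in> A"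
    using open_contains_cylinder[OF AT(1,3)] by metis
  obtain e where e: "0 < e" "\<And>\<tau>. \<bar>\<tau> - t\<bar> < e \<Longrightarrow> \<tau> \<in> T"
    using AT(2,4) unfolding open_dist dist_real_def by blast
  show thesis
  proof (cases "0 < t")
    case True
    show thesis
    proof (rule that[of s t N e])
      fix c \<tau> assume "\<And>i. - N \<le> i \<Longrightarrow> i < N \<Longrightarrow> c i = s i" "\<bar>\<tau> - t\<bar> < e"
      then show "(c, \<tau>) \<in> W" using N(2)[of c] e(2)[of \<tau>] AT(5) by blast
    qed (use True N e assms p in auto)
  next
    case False
    then have "t = 0" using assms(3) p by simp
    define t' where "t' = min (e / 2) (headroom (tame N s))"
    have t': "0 < t'" "t' \<le> e / 2" "t' \<le> headroom (tame N s)"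
      using headroom_tame_pos[of N s] N(1) e(1) by (auto simp: t'_def)
    show thesis
    proof (rule that[of "tame N s" t' N "e / 2"])
      fix c \<tau> assume c: "\<And>i. - N \<le> i \<Longrightarrow> i < N \<Longrightarrow> c i = tame N s i" and "\<bar>\<tau> - t'\<bar> < e / 2"
      then have "\<bar>\<tau> - t\<bar> < e" using t' \<open>t = 0\<close> by linarith
      moreover have "c \<in> A" by (rule N(2)) (use c in \<open>auto simp: tame_def\<close>)
      ultimately show "(c, \<tau>) \<in> W" using e(2)[of \<tau>] AT(5) by blast
    qed (use t' N(1) e(1) in auto)
  qed
qed

text \<open>Transitivity passes to factors, and \<open>splice\<close> joins any two orbits of the model fan.  Sensitivity and
  the scarcity of periodic points rest on the fact that \<open>P\<close> identifies only points of equal height.  Arbitrarily close to any point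
  there are two itineraries, one reaching a height above 3/4 at a time when the other one is below
  1/2; at that time one of the two is far from the orbit of the given point.  A periodic point
  returns to its height, so either its height is 0 or \<open>q * sqrt 2 - p = 0\<close> with \<open>p + q > 0\<close>; the latter is
  excluded by irrationality.\<close>

theorem factor_of_turn_chaotic:
  fixes P :: "(int \<Rightarrow> bool) \<times> real \<Rightarrow> 'a::metric_space"
  assumes P: "continuous_on model_fan P" "P ` model_fan = L"
    and height: "\<And>p q. p \<in> model_fan \<Longrightarrow> q \<in> model_fan \<Longrightarrow> P p = P q \<Longrightarrow> snd p = snd q"
    and f: "continuous_on L f" and semi: "\<And>p. p \<in> model_fan \<Longrightarrow> f (P p) = P (turn p)"
  shows "robinson_chaotic L f" "\<not> devaney_chaotic L f"
proof -
  have turn: "turn p \<in> model_fan" if "p \<in> model_fan" for p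
    using turn_iterate_mem[OF that, of 1] by simp
  have iter: "(f ^^ n) (P p) = P ((turn ^^ n) p)" if "p \<in> model_fan" for n p
    by (induction n) (simp_all add: semi turn_iterate_mem that)
  have Lmem: "P p \<in> L" if "p \<in> model_fan" for p using P(2) that by blast
  have "compact L" using P compact_model_fan compact_continuous_image by blast
  moreover have "f ` L \<subseteq> L"
  proof
    fix y assume "y \<in> f ` L"
    then obtain p where "p \<in> model_fan" "y = f (P p)" using P(2) by blast
    then show "y \<in> L" using semi turn Lmem by simp
  qed
  ultimately have sys: "dynamical_system L f" using f by (simp add: dynamical_system_def)
  \<comment> \<open>every non-empty open set contains the image of a box around a point of positive height\<close>
  have pull: "\<exists>s t N e. (s, t) \<in> model_fan \<and> 0 < t \<and> (1::int) \<le> N \<and> 0 < e \<and>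
      (\<forall>c \<tau>. (c, \<tau>) \<in> model_fan \<longrightarrow> (\<forall>i. - N \<le> i \<and> i < N \<longrightarrow> c i = s i) \<longrightarrow> \<bar>\<tau> - t\<bar> < e \<longrightarrow>
        P (c, \<tau>) \<in> U)"
    if U: "openin (top_of_set L) U" "U \<noteq> {}" for U
  proof -
    have "openin (top_of_set model_fan) (model_fan \<inter> P -` U)"
      by (rule continuous_openin_preimage[OF P(1) _ U(1)]) (use P(2) in auto)
    then obtain W where W: "open W" "model_fan \<inter> P -` U = model_fan \<inter> W"
      unfolding openin_open by blast
    obtain y where "y \<in> U" using U(2) by blast
    then have "y \<in> L" using openin_imp_subset[OF U(1)] by blast
    then obtain p where p: "p \<in> model_fan" "P p \<in> U" using P(2) \<open>y \<in> U\<close> by blast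
    then have "p \<in> W" using W(2) by blast
    from open_contains_branch_point[OF W(1) this p(1)]
    obtain s t N e where st: "(s, t) \<in> model_fan" "0 < t" "(1::int) \<le> N" "0 < e" and
      near: "\<And>c \<tau>. (\<And>i. - N \<le> i \<Longrightarrow> i < N \<Longrightarrow> c i = s i) \<Longrightarrow> \<bar>\<tau> - t\<bar> < e \<Longrightarrow> (c, \<tau>) \<in> W"
      by blast
    have "P (c, \<tau>) \<in> U" if "(c, \<tau>) \<in> model_fan" "\<forall>i. - N \<le> i \<and> i < N \<longrightarrow> c i = s i" "\<bar>\<tau> - t\<bar> < e" for c \<tau>
    proof -
      have "(c, \<tau>) \<in> W" by (rule near) (use that in auto)
      then show ?thesis using W(2) that(1) by blast
    qed
    then show ?thesis using st by blast
  qed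
  have trans: "transitive_on L f" unfolding transitive_on_def
  proof (intro allI impI, elim conjE)
    fix U V assume U: "openin (top_of_set L) U" "U \<noteq> {}" and V: "openin (top_of_set L) V" "V \<noteq> {}"
    from pull[OF U] obtain s t N e where s: "(s, t) \<in> model_fan" "0 < t" "(1::int) \<le> N" "0 < e"
      and nearU: "\<And>c \<tau>. (c, \<tau>) \<in> model_fan \<Longrightarrow> (\<forall>i. - N \<le> i \<and> i < N \<longrightarrow> c i = s i) \<Longrightarrow> \<bar>\<tau> - t\<bar> < e \<Longrightarrow>
        P (c, \<tau>) \<in> U" by blast
    from pull[OF V] obtain s' t' N' e' where s': "(s', t') \<in> model_fan" "0 < t'" "(1::int) \<le> N'" "0 < e'"
      and nearV: "\<And>c \<tau>. (c, \<tau>) \<in> model_fan \<Longrightarrow> (\<forall>i. - N' \<le> i \<and> i < N' \<longrightarrow> c i = s' i) \<Longrightarrow> \<bar>\<tau> - t'\<bar> < e' \<Longrightarrow>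
        P (c, \<tau>) \<in> V" by blast
    define y where "y = max (t' - e' / 2) (t' / 2)"
    have y: "0 < y" "y < t'" "t' - e' < y" using s' by (auto simp: y_def)
    define \<epsilon> where "\<epsilon> = ln (t' / y)"
    have \<epsilon>: "0 < \<epsilon>" "t' * exp (- \<epsilon>) = y" using y s' by (auto simp: \<epsilon>_def exp_minus)
    have "0 \<le> max N N'" using s(3) by simp
    from splice[OF s(1,2) s'(1,2) this \<epsilon>(1)]
    obtain c n where c: "\<forall>i<max N N'. c i = s i" "\<forall>i\<ge>- max N N'. c (i + int n) = s' i"
      "(c, t) \<in> model_fan" "y < t * exp (climb c (int n))" "t * exp (climb c (int n)) \<le> t'"
      unfolding \<epsilon>(2) by blast
    have "P (c, t) \<in> U" by (rule nearU[OF c(3)]) (use c(1) s in auto)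
    moreover have "P ((turn ^^ n) (c, t)) \<in> V"
      unfolding turn_iterate fst_conv snd_conv
    proof (rule nearV)
      show "((\<lambda>i. c (i + int n)), t * exp (climb c (int n))) \<in> model_fan"
        using turn_iterate_mem[OF c(3), of n] by (simp add: turn_iterate)
    qed (use c(2,4,5) y in auto)
    ultimately have "(f ^^ n) (P (c, t)) \<in> (f ^^ n) ` U \<inter> V"
      unfolding iter[OF c(3), symmetric] by (intro IntI imageI)
    then show "\<exists>n. (f ^^ n) ` U \<inter> V \<noteq> {}" by blast
  qed
  have "\<exists>\<epsilon>>0. \<forall>p\<in>model_fan. \<forall>q\<in>model_fan. 1/8 \<le> \<bar>snd p - snd q\<bar> \<longrightarrow> \<epsilon> < dist (P p) (P q)"
  proof -
    let ?K = "(model_fan \<times> model_fan) \<inter> {z. 1/8 \<le> \<bar>snd (fst z) - snd (snd z)\<bar>}"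
    have "closed {z :: ((int \<Rightarrow> bool) \<times> real) \<times> ((int \<Rightarrow> bool) \<times> real). 1/8 \<le> \<bar>snd (fst z) - snd (snd z)\<bar>}"
      by (intro closed_Collect_le continuous_on_const continuous_on_rabs continuous_on_diff
          continuous_on_fst continuous_on_snd continuous_on_id)
    then have K: "compact ?K" by (intro compact_Int_closed compact_Times compact_model_fan)
    show ?thesis
    proof (cases "?K = {}")
      case True
      then have "\<not> 1/8 \<le> \<bar>snd p - snd q\<bar>" if "p \<in> model_fan" "q \<in> model_fan" for p q using that by fastforce
      then show ?thesis by (intro exI[of _ 1]) simp
    next
      case False
      have "continuous_on ?K (\<lambda>z. dist (P (fst z)) (P (snd z)))"
        by (intro continuous_on_dist continuous_on_compose2[OF P(1)] continuous_on_fst continuous_on_snd continuous_on_id) auto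
      from continuous_attains_inf[OF K False this] obtain z where z: "z \<in> ?K"
        and min: "\<forall>z'\<in>?K. dist (P (fst z)) (P (snd z)) \<le> dist (P (fst z')) (P (snd z'))" by blast
      have "P (fst z) \<noteq> P (snd z)" using z height[of "fst z" "snd z"] by auto
      then have pos: "0 < dist (P (fst z)) (P (snd z))" by simp
      have "dist (P (fst z)) (P (snd z)) / 2 < dist (P p) (P q)"
        if "p \<in> model_fan" "q \<in> model_fan" "1/8 \<le> \<bar>snd p - snd q\<bar>" for p q
      proof -
        have "(p, q) \<in> ?K" using that by simp
        then have "dist (P (fst z)) (P (snd z)) \<le> dist (P p) (P q)" using bspec[OF min, of "(p, q)"] by simp
        then show ?thesis using pos by linarith
      qed
      then show ?thesis using pos by (intro exI[of _ "dist (P (fst z)) (P (snd z)) / 2"]) auto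
    qed
  qed
  then obtain \<epsilon>0 where \<epsilon>0: "0 < \<epsilon>0" and far: "\<And>p q. p \<in> model_fan \<Longrightarrow> q \<in> model_fan \<Longrightarrow>
      1/8 \<le> \<bar>snd p - snd q\<bar> \<Longrightarrow> \<epsilon>0 < dist (P p) (P q)" by blast
  have sens: "sensitive_on L f" unfolding sensitive_on_def
  proof (intro exI[of _ \<epsilon>0] conjI ballI allI impI \<epsilon>0)
    fix x \<delta> assume x: "x \<in> L" and "(0::real) < \<delta>"
    have "openin (top_of_set L) (L \<inter> ball x \<delta>)" "L \<inter> ball x \<delta> \<noteq> {}"
      using x \<open>0 < \<delta>\<close> by (auto simp: openin_open_Int)
    from pull[OF this] obtain s t N e where s: "(s, t) \<in> model_fan" "0 < t" "(1::int) \<le> N" "0 < e"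
      and near: "\<And>c \<tau>. (c, \<tau>) \<in> model_fan \<Longrightarrow> (\<forall>i. - N \<le> i \<and> i < N \<longrightarrow> c i = s i) \<Longrightarrow> \<bar>\<tau> - t\<bar> < e \<Longrightarrow>
        P (c, \<tau>) \<in> L \<inter> ball x \<delta>" by blast
    have "0 \<le> N" "(0::real) < ln (4/3)" using s by auto
    from splice[OF s(1,2) summit_in_model_fan zero_less_one this]
    obtain c1 n where c1: "\<forall>i<N. c1 i = s i" "2 * N \<le> int n" "(c1, t) \<in> model_fan"
      "1 * exp (- ln (4/3)) < t * exp (climb c1 (int n))" by blast
    define c2 where "c2 i = (if i < N then s i else False)" for i
    have k2: "climb c2 i = climb s i" if "i \<le> N" for i
      using climb_cong_le[OF \<open>0 \<le> N\<close> _ that, of c2 s] by (simp add: c2_def)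
    have k2': "climb c2 i = climb s N - of_int (i - N)" if "N \<le> i" for i
      using climb_run[of N i c2 False] that k2[of N] by (simp add: c2_def rise_def)
    have sl: "ln t + climb s i \<le> 0" for i using s in_model_fan_log by blast
    have "ln t + climb c2 i \<le> 0" for i
    proof (cases "i \<le> N")
      case False
      then have "(0::real) \<le> of_int (i - N)" by simp
      then show ?thesis using k2'[of i] False sl[of N] by linarith
    qed (simp add: k2 sl)
    then have c2: "(c2, t) \<in> model_fan" using in_model_fan_log s(2) by blast
    have "1 \<le> int n - N" using c1(2) s(3) by linarith
    then have "ln t + climb c2 (int n) \<le> - 1" using k2'[of "int n"] sl[of N] by linarith
    then have "exp (ln t + climb c2 (int n)) \<le> exp (- 1)" by simp
    moreover have "t * exp (climb c2 (int n)) = exp (ln t + climb c2 (int n))"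
      using s(2) by (simp add: exp_add)
    moreover have "exp (- 1 :: real) \<le> 1/2"
      using exp_ge_add_one_self[of "1::real"] by (simp add: exp_minus field_simps)
    ultimately have low: "t * exp (climb c2 (int n)) \<le> 1/2" by linarith
    have high: "3/4 < t * exp (climb c1 (int n))" using c1(4) by (simp add: exp_minus)
    obtain p where p: "p \<in> model_fan" "x = P p" using x P(2) by blast
    define z where "z = snd ((turn ^^ n) p)"
    have "1/8 \<le> \<bar>z - t * exp (climb c1 (int n))\<bar> \<or> 1/8 \<le> \<bar>z - t * exp (climb c2 (int n))\<bar>"
      using low high by linarith
    then obtain c where c: "c = c1 \<or> c = c2" "1/8 \<le> \<bar>z - t * exp (climb c (int n))\<bar>" by blast
    then have cm: "(c, t) \<in> model_fan" using c1 c2 by blast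
    have "P (c, t) \<in> L \<inter> ball x \<delta>"
      by (rule near[OF cm]) (use c(1) c1(1) s in \<open>auto simp: c2_def\<close>)
    moreover have "\<epsilon>0 < dist ((f ^^ n) x) ((f ^^ n) (P (c, t)))"
      unfolding p(2) iter[OF p(1)] iter[OF cm]
    proof (rule far)
      show "1/8 \<le> \<bar>snd ((turn ^^ n) p) - snd ((turn ^^ n) (c, t))\<bar>"
        using c(2) by (simp add: z_def turn_iterate)
    qed (rule turn_iterate_mem p cm)+
    moreover have "0 < n" using c1(2) s(3) by (cases n) auto
    ultimately show "\<exists>y\<in>L. dist x y < \<delta> \<and> (\<exists>n>0. \<epsilon>0 < dist ((f ^^ n) x) ((f ^^ n) y))" by auto
  qed
  show "robinson_chaotic L f" using sys trans sens by (simp add: robinson_chaotic_def)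
  let ?Z = "model_fan \<inter> {p. snd p = 0}"
  have "periodic_points_on L f \<subseteq> P ` ?Z"
  proof
    fix y assume "y \<in> periodic_points_on L f"
    then obtain n where n: "y \<in> L" "0 < n" "(f ^^ n) y = y" by (auto simp: periodic_points_on_def)
    then obtain p where p: "p \<in> model_fan" "y = P p" using P(2) by blast
    then have "snd ((turn ^^ n) p) = snd p"
      using n(3) iter by (intro height turn_iterate_mem) auto
    then have "snd p = 0 \<or> climb (fst p) (int n) = 0" by (simp add: turn_iterate)
    moreover have "climb (fst p) (int n) \<noteq> 0"
    proof
      let ?A = "{j \<in> {0..<int n}. fst p j}" and ?B = "{j \<in> {0..<int n}. \<not> fst p j}"
      have fin: "finite ?A" "finite ?B"
        by (rule finite_subset[OF Collect_subset finite_atLeastLessThan_int])+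
      have "climb (fst p) (int n) = (\<Sum>j\<in>{0..<int n}. rise (fst p j))" by (simp add: climb_def)
      also have "\<dots> = (\<Sum>j\<in>?A. rise (fst p j)) + (\<Sum>j\<in>?B. rise (fst p j))"
        by (subst sum.union_disjoint[symmetric, OF fin]) (auto intro!: sum.cong)
      also have "\<dots> = of_int (int (card ?A)) * sqrt 2 - of_int (int (card ?B))"
        by (simp add: rise_def)
      finally have eq: "climb (fst p) (int n) = of_int (int (card ?A)) * sqrt 2 - of_int (int (card ?B))" .
      assume "climb (fst p) (int n) = 0"
      with eq have "of_int (int (card ?A)) * sqrt 2 = of_int (int (card ?B))" by linarith
      from sqrt2_combination_zero[OF this] have "card ?A = 0" "card ?B = 0" by simp_all
      then have "?A = {}" "?B = {}" by (simp_all only: card_0_eq fin)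
      then have "{0..<int n} = {}" by blast
      then show False using n(2) by simp
    qed
    ultimately show "y \<in> P ` ?Z" using p by blast
  qed
  moreover have "compact (P ` ?Z)"
  proof (rule compact_continuous_image)
    show "continuous_on ?Z P" by (rule continuous_on_subset[OF P(1)]) blast
    have "closed {p :: (int \<Rightarrow> bool) \<times> real. snd p = 0}"
      by (intro closed_Collect_eq continuous_on_snd continuous_on_id continuous_on_const)
    then show "compact ?Z" by (intro compact_Int_closed compact_model_fan)
  qed
  ultimately have "closure (periodic_points_on L f) \<subseteq> P ` ?Z"
    by (simp add: closure_minimal compact_imp_closed)
  moreover have "P ((\<lambda>i. i < 0), 1) \<in> L - P ` ?Z"
    using height[OF summit_in_model_fan] Lmem[OF summit_in_model_fan] by force
  ultimately show "\<not> devaney_chaotic L f" unfolding devaney_chaotic_def by blast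
qed

section \<open>The homeomorphism and the non-injective map\<close>

lemma lelek_fan_itinerary_chart:
  fixes L :: "'a::metric_space set"
  assumes "lelek_fan L" "J \<subseteq> {..<0}"
  obtains \<pi> where "fan_chart (itineraries J) headroom \<pi> L"
proof -
  obtain C :: "real set" and \<phi> B \<pi>\<^sub>0 where "lelek_function C \<phi> B" and chart: "fan_chart C \<phi> \<pi>\<^sub>0 L"
    using lelek_fan_chart[OF assms(1)] by metis
  then interpret lelek_pair "itineraries J" headroom reads C \<phi> B
    by (intro lelek_pair.intro lelek_function_headroom assms(2))
  from fan_chart_transfer[OF chart] that show thesis by metis
qed

lemma fan_chart_height:
  "fan_chart C \<phi> \<pi> L \<Longrightarrow> p \<in> fan_body C \<phi> \<Longrightarrow> q \<in> fan_body C \<phi> \<Longrightarrow> \<pi> p = \<pi> q \<Longrightarrow> snd p = snd q"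
  unfolding fan_chart_def by metis

lemma turn_inj: "inj turn"
proof (rule injI)
  fix p q assume eq: "turn p = turn q"
  have "fst p = fst q"
  proof
    fix i
    have "fst (turn p) (i - 1) = fst (turn q) (i - 1)" using eq by simp
    then show "fst p i = fst q i" by (simp add: turn_def)
  qed
  moreover from this have "snd p = snd q" using eq by (simp add: turn_def)
  ultimately show "p = q" by (rule prod_eqI)
qed

text \<open>The inverse of \<open>turn\<close> divides by the factor belonging to the letter at time \<open>- 1\<close>.\<close>

lemma turn_image: "turn ` model_fan = model_fan"
proof
  show "turn ` model_fan \<subseteq> model_fan" using turn_iterate_mem[of _ 1] by auto
  show "model_fan \<subseteq> turn ` model_fan"
  proof
    fix p assume p: "p \<in> model_fan"
    obtain s t where st: "p = (s, t)" by (cases p)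
    then have mem: "0 \<le> t" "\<And>i. t * exp (climb s i) \<le> 1" using p in_model_fan by blast+
    let ?q = "((\<lambda>i. s (i + - 1)), t * exp (- rise (s (- 1))))"
    have "climb s (- 1) = - rise (s (- 1))" using climb_step[of s "- 1"] by simp
    then have "t * exp (- rise (s (- 1))) * exp (climb (\<lambda>i. s (i + - 1)) i) = t * exp (climb s (i + - 1))" for i
      unfolding climb_shift[of s "- 1" i] by (simp flip: exp_add)
    then have "t * exp (- rise (s (- 1))) * exp (climb (\<lambda>i. s (i + - 1)) i) \<le> 1" for i
      using mem(2)[of "i + - 1"] by (simp only:)
    then have "?q \<in> model_fan" unfolding in_model_fan using mem(1) by (intro conjI allI) (simp, blast)
    moreover have "p = turn ?q" by (simp add: turn_def st flip: exp_add)
    ultimately show "p \<in> turn ` model_fan" by (rule rev_image_eqI)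
  qed
qed

theorem chaotic_homeomorphism:
  fixes L :: "'a::metric_space set"
  assumes "lelek_fan L"
  shows "\<exists>h. (\<exists>k. homeomorphism L L h k) \<and> robinson_chaotic L h \<and> \<not> devaney_chaotic L h"
proof -
  obtain \<pi> where chart: "fan_chart UNIV headroom \<pi> L"
    using lelek_fan_itinerary_chart[OF assms, of "{}"] by (auto simp: itineraries_def)
  have cont: "continuous_on model_fan turn" using continuous_turn continuous_on_subset by blast
  obtain h where h: "continuous_on L h" "h ` L \<subseteq> L" "\<And>p. p \<in> model_fan \<Longrightarrow> h (\<pi> p) = \<pi> (turn p)"
  proof (rule fan_chart_lift[OF chart compact_model_fan cont])
    show "turn ` model_fan \<subseteq> model_fan" by (simp add: turn_image)
    show "snd p = 0 \<Longrightarrow> snd (turn p) = 0" for p by (simp add: turn_def)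
  qed blast
  have \<pi>: "continuous_on model_fan \<pi>" "\<pi> ` model_fan = L"
    and fib: "\<And>p q. p \<in> model_fan \<Longrightarrow> q \<in> model_fan \<Longrightarrow> \<pi> p = \<pi> q \<longleftrightarrow> p = q \<or> snd p = 0 \<and> snd q = 0"
    using chart unfolding fan_chart_def by blast+
  have height: "snd p = snd q" if "p \<in> model_fan" "q \<in> model_fan" "\<pi> p = \<pi> q" for p q
    by (rule fan_chart_height[OF chart that])
  have chaos: "robinson_chaotic L h" "\<not> devaney_chaotic L h"
    using factor_of_turn_chaotic[OF \<pi> height h(1,3)] by blast+
  have tm: "turn p \<in> model_fan" if "p \<in> model_fan" for p using turn_image that by blast
  have "h ` L = \<pi> ` (turn ` model_fan)" unfolding \<pi>(2)[symmetric] image_image using h(3) by simp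
  then have surj: "h ` L = L" by (simp add: turn_image \<pi>(2))
  have "inj_on h L"
  proof (rule inj_onI)
    fix x y assume "x \<in> L" "y \<in> L" "h x = h y"
    then obtain p q where pq: "p \<in> model_fan" "q \<in> model_fan" "x = \<pi> p" "y = \<pi> q" using \<pi>(2) by blast
    then have "\<pi> (turn p) = \<pi> (turn q)" using h(3) \<open>h x = h y\<close> by simp
    then have "turn p = turn q \<or> snd (turn p) = 0 \<and> snd (turn q) = 0" using fib tm pq by blast
    moreover have "snd (turn r) = 0 \<longleftrightarrow> snd r = 0" for r by (simp add: turn_def)
    ultimately have "p = q \<or> snd p = 0 \<and> snd q = 0" using injD[OF turn_inj] by blast
    then show "x = y" using fib pq by blast
  qed
  moreover have "compact L" using chaos(1) by (simp add: robinson_chaotic_def dynamical_system_def)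
  ultimately have inverse: "\<exists>k. homeomorphism L L h k" using homeomorphism_compact[OF _ h(1) surj] by blast
  show ?thesis by (rule exI[of _ h]) (intro conjI inverse chaos)
qed

text \<open>Forgetting the past.  The map \<open>reset\<close> retracts the model fan onto the fan over the itineraries with
  frozen past and makes \<open>reset \<circ> turn\<close> on the latter a factor of \<open>turn\<close>.\<close>

definition reset :: "(int \<Rightarrow> bool) \<times> real \<Rightarrow> (int \<Rightarrow> bool) \<times> real" where
  "reset p = ((\<lambda>i. i < 0 \<or> fst p i), snd p)"

abbreviation future_fan :: "((int \<Rightarrow> bool) \<times> real) set" where
  "future_fan \<equiv> fan_body (itineraries {..<0}) headroom"

lemma continuous_reset: "continuous_on UNIV reset"
proof -
  have "continuous_on UNIV (\<lambda>p :: (int \<Rightarrow> bool) \<times> real. i < 0 \<or> fst p i)" for i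
    using continuous_fst_coordinate[of i] by (cases "i < 0") simp_all
  then have "continuous_on UNIV (\<lambda>p :: (int \<Rightarrow> bool) \<times> real. \<lambda>i. i < 0 \<or> fst p i)"
    by (rule continuous_on_coordinatewise_then_product)
  then show ?thesis unfolding reset_def[abs_def]
    by (intro continuous_on_Pair continuous_on_snd continuous_on_id)
qed

lemma reset_future: "p \<in> future_fan \<Longrightarrow> reset p = p"
  by (cases p) (auto simp: reset_def itineraries_def)

lemma future_fan_subset: "future_fan \<subseteq> model_fan"
  by (auto simp: fan_body_def)

lemma reset_mem:
  assumes "p \<in> model_fan" shows "reset p \<in> future_fan"
proof -
  obtain s t where p: "p = (s, t)" by (cases p)
  then have mem: "0 \<le> t" "\<And>i. t * exp (climb s i) \<le> 1" using assms in_model_fan by blast+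
  let ?s = "\<lambda>i. i < 0 \<or> s i"
  have "t * exp (climb ?s i) \<le> 1" for i
  proof (cases "0 \<le> i")
    case True
    then have "climb ?s i = climb s i" using climb_diff_cong[of 0 i ?s 0 s] by simp
    then show ?thesis using mem by simp
  next
    case False
    then have "climb ?s i = of_int i * sqrt 2"
      using climb_run[of i 0 ?s True] by (simp add: rise_def)
    then have "exp (climb ?s i) \<le> 1" using False by (simp add: mult_le_0_iff)
    then have "t * exp (climb ?s i) \<le> t * 1" using mem(1) by (rule mult_left_mono)
    then show ?thesis using mem(2)[of 0] by simp
  qed
  then show ?thesis using mem(1) by (simp add: p reset_def itineraries_def le_headroom_iff)
qed

lemma reset_image: "reset ` model_fan = future_fan"
proof
  show "reset ` model_fan \<subseteq> future_fan" using reset_mem by blast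
  show "future_fan \<subseteq> reset ` model_fan"
  proof
    fix p assume p: "p \<in> future_fan"
    then have "p \<in> model_fan" using future_fan_subset by blast
    then show "p \<in> reset ` model_fan" using reset_future[OF p] by (metis imageI)
  qed
qed

lemma reset_turn_reset: "reset (turn (reset p)) = reset (turn p)"
  by (auto simp: reset_def turn_def)

text \<open>Injectivity fails because \<open>reset \<circ> turn\<close> forgets the letter at time 0: a point that descends from height 1
  and one that climbs from a suitably lower height have the same image.\<close>

theorem chaotic_noninjective_map:
  fixes L :: "'a::metric_space set"
  assumes "lelek_fan L"
  shows "\<exists>f. continuous_on L f \<and> f ` L \<subseteq> L \<and> \<not> (\<exists>k. homeomorphism L L f k) \<and>
              robinson_chaotic L f \<and> \<not> devaney_chaotic L f"
proof -
  obtain \<pi> where chart: "fan_chart (itineraries {..<0}) headroom \<pi> L"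
    using lelek_fan_itinerary_chart[OF assms] by blast
  have \<pi>: "continuous_on future_fan \<pi>" "\<pi> ` future_fan = L"
    and fib: "\<And>p q. p \<in> future_fan \<Longrightarrow> q \<in> future_fan \<Longrightarrow> \<pi> p = \<pi> q \<longleftrightarrow> p = q \<or> snd p = 0 \<and> snd q = 0"
    using chart unfolding fan_chart_def by blast+
  have tm: "turn p \<in> model_fan" if "p \<in> model_fan" for p using turn_image that by blast
  have cont: "continuous_on future_fan (\<lambda>p. reset (turn p))"
    by (rule continuous_on_compose2[OF continuous_reset]) (use continuous_turn continuous_on_subset in auto)
  obtain f where f: "continuous_on L f" "f ` L \<subseteq> L"
    "\<And>p. p \<in> future_fan \<Longrightarrow> f (\<pi> p) = \<pi> (reset (turn p))"
  proof (rule fan_chart_lift[OF chart compact_model_body cont])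
    show "(\<lambda>p. reset (turn p)) ` future_fan \<subseteq> future_fan"
      using reset_mem tm future_fan_subset by blast
    show "snd p = 0 \<Longrightarrow> snd (reset (turn p)) = 0" for p by (simp add: turn_def reset_def)
  qed blast
  have P: "continuous_on model_fan (\<lambda>p. \<pi> (reset p))"
    by (rule continuous_on_compose2[OF \<pi>(1) continuous_on_subset[OF continuous_reset]])
      (simp_all add: reset_image)
  have "(\<lambda>p. \<pi> (reset p)) ` model_fan = \<pi> ` (reset ` model_fan)" by (simp add: image_image)
  then have img: "(\<lambda>p. \<pi> (reset p)) ` model_fan = L" by (simp add: reset_image \<pi>(2))
  have height: "snd p = snd q"
    if "p \<in> model_fan" "q \<in> model_fan" "\<pi> (reset p) = \<pi> (reset q)" for p q
    using fan_chart_height[OF chart reset_mem[OF that(1)] reset_mem[OF that(2)] that(3)] by (simp add: reset_def)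
  have semi: "f (\<pi> (reset p)) = \<pi> (reset (turn p))" if "p \<in> model_fan" for p
    using f(3)[OF reset_mem[OF that]] by (simp add: reset_turn_reset)
  have chaos: "robinson_chaotic L f" "\<not> devaney_chaotic L f"
    using factor_of_turn_chaotic[OF P img height f(1) semi] by blast+
  let ?a = "\<lambda>i::int. i < 0" and ?b = "\<lambda>i::int. i < 1"
  \<comment> \<open>both points move to height \<open>exp (- 1)\<close>\<close>
  define t where "t = exp (- 1 - sqrt 2)"
  have a: "(?a, 1) \<in> future_fan"
    using summit_in_model_fan by (simp add: itineraries_def)
  have "1 * exp (climb ?a j) \<le> 1" for j using summit_in_model_fan in_model_fan by blast
  then have ca: "climb ?a j \<le> 0" for j by simp
  have "climb ?a (- 1) = - sqrt 2" using climb_step[of ?a "- 1"] by (simp add: rise_def)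
  then have "climb ?b i = climb ?a (i + - 1) + sqrt 2" for i
    using climb_shift[of ?a "- 1" i] by simp
  then have "climb ?b i \<le> sqrt 2" for i using ca[of "i + - 1"] by simp
  then have "t * exp (climb ?b i) \<le> 1" for i
    unfolding t_def exp_add[symmetric] exp_le_one_iff by (smt (verit))
  then have b: "(?b, t) \<in> future_fan" by (simp add: itineraries_def le_headroom_iff t_def)
  have "reset (turn (?a, 1)) = reset (turn (?b, t))"
    by (auto simp: reset_def turn_def rise_def t_def simp flip: exp_add)
  then have "f (\<pi> (?a, 1)) = f (\<pi> (?b, t))" using f(3) a b by simp
  moreover have "\<pi> (?a, 1) \<noteq> \<pi> (?b, t)"
  proof -
    have "(?a, 1) \<noteq> (?b, t)" by (auto dest: fun_cong[of _ _ 0])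
    then show ?thesis using fib[OF a b] by simp
  qed
  moreover have "\<pi> (?a, 1) \<in> L" "\<pi> (?b, t) \<in> L" using a b \<pi>(2) by blast+
  ultimately have "\<not> inj_on f L" by (meson inj_onD)
  moreover have "inj_on f L" if "homeomorphism L L f k" for k
    using homeomorphism_apply1[OF that] by (rule inj_on_inverseI)
  ultimately have no_inverse: "\<not> (\<exists>k. homeomorphism L L f k)" by blast
  show ?thesis by (rule exI[of _ f]) (intro conjI f(1,2) chaos no_inverse)
qed

theorem corollary5p8:
  fixes L :: "'a::metric_space set"
  assumes "lelek_fan L"
  shows "(\<exists>h. (\<exists>k. homeomorphism L L h k) \<and> robinson_chaotic L h \<and> \<not> devaney_chaotic L h) \<and>
         (\<exists>f. continuous_on L f \<and> f ` L \<subseteq> L \<and> \<not> (\<exists>k. homeomorphism L L f k) \<and>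
              robinson_chaotic L f \<and> \<not> devaney_chaotic L f)"
  using chaotic_homeomorphism[OF assms] chaotic_noninjective_map[OF assms] by blast

end
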